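(* Let $\gamma(\lambda)=(\gamma_{kj}(\lambda))_{k,j=1,2}$ be the matrix defined by $E(x,\lambda)=S(x,\lambda)\gamma(\lambda)$, $x>0$, for $\arg\lambda\in(0,\pi/2]$ and $|\lambda|$ sufficiently large, and let $\gamma^0=(\gamma^0_{kj})$ be the constant matrix defined by $e(x)=C(x)\gamma^0$, $x\in\Pi_-$, with $E,S,e,C$ as in the context. Then, with $\mu_1=-\mu$, $\mu_2=\mu$ and $\nu=\min\{1,2\,\mathrm{Re}\,\mu\}$: 1) $\gamma_{j2}(\lambda)=\lambda^{\mu_j}\gamma^0_{j2}$, $j=1,2$; 2) $\gamma_{j1}(\lambda)=\lambda^{\mu_j}\gamma^0_{j1}\bigl(1+O(|\lambda|^{-\nu})\bigr)$ as $|\lambda|\to\infty$, $j=1,2$.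
   Context: **Standing assumptions.** $\mu\in\mathbb C$, $\mathrm{Re}\,\mu>0$, $\mu-\tfrac12\notin\{0,1,2,\dots\}$; $\mu_1=-\mu$, $\mu_2=\mu$. Put $$B=\begin{pmatrix}0&1\\ -1&0\end{pmatrix},\ J=\begin{pmatrix}0&1\\ 1&0\end{pmatrix},\ I=\begin{pmatrix}1&0\\ 0&1\end{pmatrix},\ Q_0(x)=\frac{\mu}{x}J,\ Q(x)=\begin{pmatrix}q_1(x)&q_2(x)\\ q_2(x)&-q_1(x)\end{pmatrix},$$ where $q_1,q_2$ are complex-valued absolutely continuous functions on $\mathbb R$ with $q_j'\in L(-\infty,+\infty)$ and $$\int_{|x|\le1}|x|^{-2\mathrm{Re}\,\mu}|Q(x)|\,dx+\int_{|x|\ge1}|Q(x)|\,dx<\infty .$$ Powers use $\arg\in(-\pi,\pi]$; $\Pi_-=\mathbb C\setminus(-\infty,0]$; $T$ denotes transposition. The Dirac system under study is $$BY'(x)+(Q_0(x)+Q(x))Y(x)=\lambda Y(x),\qquad x>0.\tag{D}$$ **Model system** $BY'(x)+Q_0(x)Y(x)=Y(x)$, $x\in\Pi_-$. Fix numbers $c_{10},c_{20}$ with $c_{10}c_{20}=1$ and set $$c_{j,2k}=\frac{(-1)^kc_{j0}}{2^kk!\prod_{s=0}^{k-1}(2\mu_j+1+2s)},\quad c_{j,2k+1}=\frac{(-1)^kc_{j0}}{2^kk!\prod_{s=0}^{k}(2\mu_j+1+2s)},\quad \widehat C(x)=\sum_{k=0}^\infty x^{2k}\begin{pmatrix}xc_{1,2k+1}&c_{2,2k}\\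 -c_{1,2k}&xc_{2,2k+1}\end{pmatrix}.$$ $C(x)=\widehat C(x)\,\mathrm{diag}(x^{\mu_1},x^{\mu_2})$ is a fundamental matrix of the model system with $\det C\equiv1$. With $R_1=i$, $R_2=-i$, the model system also has solutions $e_1,e_2$, analytic in $\Pi_-$, uniquely determined by: for each $\delta_0\in(0,\pi)$, $e^{-R_jx}e_j(x)=(R_j,1)^T+O(1/|x|)$ as $|x|\to\infty$, uniformly in $\arg x\in[-\pi+\delta_0,\pi]$ for $j=1$ and uniformly in $\arg x\in[-\pi,\pi-\delta_0]$ for $j=2$ (values at $\arg x=\pm\pi$ are boundary values on the corresponding side of the cut). $e(x)=(e_1(x),e_2(x))$ is the matrix with these columns. For $x>0$ put $e(x,\lambda)=e(x\lambda)$ and let $C(x,\lambda)$ have columns $C_j(x,\lambda)=x^{\mu_j}\widehat C_j(x,\lambda)$, $\widehat C_j(x,\lambda)=\widehat C_j(x\lambda)$, where $\widehat C_j$ is the $j$th column of $\widehat C$. **The solutions $S$.** $S(x,\lambda)=(S_1(x,\lambda),S_2(x,\lambda))$ is the fundamental matrix of (D) with $S_j(x,\lambda)=x^{\mu_j}\widehat S_j(x,\lambda)$, where $\widehat S_j$ is the (locally bounded) solution of the Volterra equation $$\widehat S_j(x,\lambda)=\widehat C_j(x,\lambda)+\int_0^xC(x,\lambda)C^{-1}(t,\lambda)\Bigl(\frac tx\Bigr)^{\mu_j}BQ(t)\widehat S_j(t,\lambda)\,dt,\quad j=1,2.$$ **The Birkhoff-type solutions $E$** ($x,t>0$, $\arg\lambda\in(0,\pi/2]$).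 $a_\lambda=2|\mu|/|\lambda|$; $$F_j(x\lambda)=\begin{cases}(x\lambda)^{-\mu},&|x\lambda|<2|\mu|,\\ e^{R_j\lambda x},&|x\lambda|\ge2|\mu|,\end{cases}\qquad F(x\lambda)=\mathrm{diag}(F_1(x\lambda),F_2(x\lambda)),$$ $U^0(x,\lambda)=(U^0_1,U^0_2)(x,\lambda)=e(x,\lambda)F^{-1}(x\lambda)$, $U^{0,T}=(U^0)^T$; $B_1=\begin{pmatrix}0&1\\ 0&0\end{pmatrix}$, $B_2=\begin{pmatrix}0&0\\ -1&0\end{pmatrix}$; $Q(x,\lambda)=Q_0(x)-\lambda I$, $Q^{-1}(x,\lambda)=(Q(x,\lambda))^{-1}$; $$L(t,\lambda)=\bigl(Q^{-1}(t,\lambda)Q(t)\bigr)'+Q^{-1}(t,\lambda)\bigl(Q(t)BQ(t)+Q(t)BQ(t,\lambda)+Q(t,\lambda)BQ(t)\bigr),\quad '=\tfrac{d}{dt};$$ $$N(x,t,\lambda)=F_2(t\lambda)^2\,\frac{F_1(x\lambda)}{F_2(x\lambda)}\,B_1+F_1(t\lambda)F_2(t\lambda)\,B_2 .$$ For $|\lambda|$ sufficiently large, $U_1(x,\lambda)$ and $U_2(x,\lambda)$ denote the bounded (in $x>0$) solutions, satisfying $|U_j(x,\lambda)-U_j^0(x,\lambda)|\le M|\lambda|^{-\nu}$ with $M$ independent of $x$ and $\lambda$, of the following equations. For $U_1$: if $x\ge a_\lambda$, $$\begin{aligned}U_1(x,\lambda)={}&U^0_1(x,\lambda)-\tfrac12Q^{-1}(x,\lambda)Q(x)U_1(x,\lambda)+\tfrac1{2i}U^0(x,\lambda)\Bigl(B_1\int_0^{a_\lambda}F_1(t\lambda)F_2(t\lambda)U^{0,T}(t,\lambda)Q(t)U_1(t,\lambda)\,dt\\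 &-\tfrac12B_1\int_{a_\lambda}^xF_1(t\lambda)F_2(t\lambda)U^{0,T}(t,\lambda)BL(t,\lambda)U_1(t,\lambda)\,dt+\tfrac12B_2\int_x^\infty F_1^2(t\lambda)\tfrac{F_2(x\lambda)}{F_1(x\lambda)}U^{0,T}(t,\lambda)BL(t,\lambda)U_1(t,\lambda)\,dt\\ &-\tfrac12B_1F_1(a_\lambda\lambda)F_2(a_\lambda\lambda)U^{0,T}(a_\lambda,\lambda)BQ^{-1}(a_\lambda,\lambda)Q(a_\lambda)U_1(a_\lambda,\lambda)\Bigr),\end{aligned}$$ and if $0<x<a_\lambda$, $$\begin{aligned}U_1(x,\lambda)={}&U^0_1(x,\lambda)+\tfrac1{2i}U^0(x,\lambda)\Bigl(B_1\int_0^xF_1(t\lambda)F_2(t\lambda)U^{0,T}(t,\lambda)Q(t)U_1(t,\lambda)\,dt-B_2\int_x^{a_\lambda}F_1^2(t\lambda)U^{0,T}(t,\lambda)Q(t)U_1(t,\lambda)\,dt\\ &+\tfrac12B_2\int_{a_\lambda}^\infty F_1^2(t\lambda)U^{0,T}(t,\lambda)BL(t,\lambda)U_1(t,\lambda)\,dt+\tfrac12B_2F_1^2(a_\lambda\lambda)U^{0,T}(a_\lambda,\lambda)BQ^{-1}(a_\lambda,\lambda)Q(a_\lambda)U_1(a_\lambda,\lambda)\Bigr).\end{aligned}$$ For $U_2$: if $x\ge a_\lambda$, $$\begin{aligned}U_2(x,\lambda)={}&U^0_2(x,\lambda)-\tfrac12Q^{-1}(x,\lambda)Q(x)U_2(x,\lambda)+\tfrac1{2i}U^0(x,\lambda)\Bigl(\int_0^{a_\lambda}N(x,t,\lambda)U^{0,T}(t,\lambda)Q(t)U_2(t,\lambda)\,dt\\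 &-\tfrac12\int_{a_\lambda}^xN(x,t,\lambda)U^{0,T}(t,\lambda)BL(t,\lambda)U_2(t,\lambda)\,dt-\tfrac12N(x,a_\lambda,\lambda)U^{0,T}(a_\lambda,\lambda)BQ^{-1}(a_\lambda,\lambda)Q(a_\lambda)U_2(a_\lambda,\lambda)\Bigr),\end{aligned}$$ and if $0<x<a_\lambda$, $$U_2(x,\lambda)=U^0_2(x,\lambda)+\tfrac1{2i}U^0(x,\lambda)\int_0^xN(x,t,\lambda)U^{0,T}(t,\lambda)Q(t)U_2(t,\lambda)\,dt .$$ Finally $E(x,\lambda)=(E_1(x,\lambda),E_2(x,\lambda))=U(x,\lambda)F(x\lambda)$ with $U=(U_1,U_2)$; for $|\lambda|$ sufficiently large its columns are solutions of (D) on $x>0$. *)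

theory Defs
  imports "HOL-Analysis.Analysis" "HOL-Library.Landau_Symbols"
begin

text \<open>
  The two indices j = 1, 2 are the elements of the type \<open>2\<close>. A family of two columns is a
  function \<open>2 \<Rightarrow> \<dots> \<Rightarrow> complex ^ 2\<close>; \<open>of_cols\<close> assembles it into a matrix.
\<close>

definition of_cols :: "(2 \<Rightarrow> complex ^ 2) \<Rightarrow> complex ^ 2 ^ 2" where
  "of_cols f = (\<chi> i j. f j $ i)"

definition diag :: "(2 \<Rightarrow> complex) \<Rightarrow> complex ^ 2 ^ 2" where
  "diag d = (\<chi> i j. if i = j then d i else 0)"

definition cscale :: "complex \<Rightarrow> complex ^ 2 ^ 2 \<Rightarrow> complex ^ 2 ^ 2" (infixr \<open>*m\<close> 75) where
  "c *m A = (\<chi> i j. c * A $ i $ j)"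

definition Bmat :: "complex ^ 2 ^ 2" where
  "Bmat = vector [vector [0, 1], vector [-1, 0]]"

definition Jmat :: "complex ^ 2 ^ 2" where
  "Jmat = vector [vector [0, 1], vector [1, 0]]"

definition B1mat :: "complex ^ 2 ^ 2" where
  "B1mat = vector [vector [0, 1], vector [0, 0]]"

definition B2mat :: "complex ^ 2 ^ 2" where
  "B2mat = vector [vector [0, 0], vector [-1, 0]]"

definition Q0 :: "complex \<Rightarrow> complex \<Rightarrow> complex ^ 2 ^ 2" where
  "Q0 \<mu> z = (\<mu> / z) *m Jmat"

definition Qpot :: "(real \<Rightarrow> complex) \<Rightarrow> (real \<Rightarrow> complex) \<Rightarrow> real \<Rightarrow> complex ^ 2 ^ 2" where
  "Qpot q1 q2 x = vector [vector [q1 x, q2 x], vector [q2 x, - q1 x]]"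

definition mu_j :: "complex \<Rightarrow> 2 \<Rightarrow> complex" where
  "mu_j \<mu> j = (if j = 1 then - \<mu> else \<mu>)"

definition R_j :: "2 \<Rightarrow> complex" where
  "R_j j = (if j = 1 then \<i> else - \<i>)"

definition Pi_minus :: "complex set" where
  "Pi_minus = {z. \<not> (Im z = 0 \<and> Re z \<le> 0)}"


section \<open>Assumptions on the potential\<close>

definition abs_continuous_on :: "real set \<Rightarrow> (real \<Rightarrow> complex) \<Rightarrow> bool" where
  "abs_continuous_on S f \<longleftrightarrow>
     (\<forall>\<epsilon>>0. \<exists>\<delta>>0. \<forall>(n::nat) (a :: nat \<Rightarrow> real) b.
        (\<forall>i<n. a i \<le> b i \<and> {a i..b i} \<subseteq> S) \<longrightarrow>
        (\<forall>i<n. \<forall>k<n. i \<noteq> k \<longrightarrow> {a i<..<b i} \<inter> {a k<..<b k} = {}) \<longrightarrow>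
        (\<Sum>i<n. b i - a i) < \<delta> \<longrightarrow>
        (\<Sum>i<n. dist (f (a i)) (f (b i))) < \<epsilon>)"

text \<open>
  An absolutely continuous function is differentiable almost everywhere; the unspecified value of
  \<open>vector_derivative\<close> on the exceptional null set does not affect the Lebesgue integrals below.
\<close>

definition admissible_potential ::
  "complex \<Rightarrow> (real \<Rightarrow> complex) \<Rightarrow> (real \<Rightarrow> complex) \<Rightarrow> bool" where
  "admissible_potential \<mu> q1 q2 \<longleftrightarrow>
     (\<forall>q\<in>{q1, q2}. abs_continuous_on UNIV q \<and>
        (\<lambda>x. vector_derivative q (at x)) absolutely_integrable_on UNIV) \<and>
     (\<lambda>x. \<bar>x\<bar> powr (- 2 * Re \<mu>) * norm (Qpot q1 q2 x)) absolutely_integrable_on {x. \<bar>x\<bar> \<le> 1} \<and>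
     (\<lambda>x. norm (Qpot q1 q2 x)) absolutely_integrable_on {x. \<bar>x\<bar> \<ge> 1}"

definition fundamental_matrix_D ::
  "complex \<Rightarrow> (real \<Rightarrow> complex) \<Rightarrow> (real \<Rightarrow> complex) \<Rightarrow> complex \<Rightarrow>
     (real \<Rightarrow> complex ^ 2 ^ 2) \<Rightarrow> bool" where
  "fundamental_matrix_D \<mu> q1 q2 lam Y \<longleftrightarrow>
     (\<forall>x>0. invertible (Y x) \<and>
        (\<exists>Y'. (Y has_vector_derivative Y') (at x) \<and>
           Bmat ** Y' + (Q0 \<mu> (of_real x) + Qpot q1 q2 x) ** Y x = lam *m Y x))"


section \<open>The model system\<close>

text \<open>\<open>c_even \<mu> c0 j k\<close> and \<open>c_odd \<mu> c0 j k\<close> have the indices 2k and 2k+1; \<open>c0 j\<close> is the index 0.\<close>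

definition c_even :: "complex \<Rightarrow> (2 \<Rightarrow> complex) \<Rightarrow> 2 \<Rightarrow> nat \<Rightarrow> complex" where
  "c_even \<mu> c0 j k =
     (-1) ^ k * c0 j / (2 ^ k * fact k * (\<Prod>s<k. 2 * mu_j \<mu> j + 1 + 2 * of_nat s))"

definition c_odd :: "complex \<Rightarrow> (2 \<Rightarrow> complex) \<Rightarrow> 2 \<Rightarrow> nat \<Rightarrow> complex" where
  "c_odd \<mu> c0 j k =
     (-1) ^ k * c0 j / (2 ^ k * fact k * (\<Prod>s\<le>k. 2 * mu_j \<mu> j + 1 + 2 * of_nat s))"

definition Chat :: "complex \<Rightarrow> (2 \<Rightarrow> complex) \<Rightarrow> complex \<Rightarrow> complex ^ 2 ^ 2" where
  "Chat \<mu> c0 z =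
     (\<Sum>k. z ^ (2 * k) *m
        vector [vector [z * c_odd \<mu> c0 1 k, c_even \<mu> c0 2 k],
                vector [- c_even \<mu> c0 1 k, z * c_odd \<mu> c0 2 k]])"

definition Cmodel :: "complex \<Rightarrow> (2 \<Rightarrow> complex) \<Rightarrow> complex \<Rightarrow> complex ^ 2 ^ 2" where
  "Cmodel \<mu> c0 z = Chat \<mu> c0 z ** diag (\<lambda>j. z powr mu_j \<mu> j)"

definition Clam :: "complex \<Rightarrow> (2 \<Rightarrow> complex) \<Rightarrow> real \<Rightarrow> complex \<Rightarrow> complex ^ 2 ^ 2" where
  "Clam \<mu> c0 x lam = of_cols (\<lambda>j. (of_real x powr mu_j \<mu> j) *s column j (Chat \<mu> c0 (of_real x * lam)))"

definition model_solution :: "complex \<Rightarrow> (complex \<Rightarrow> complex ^ 2) \<Rightarrow> bool" where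
  "model_solution \<mu> y \<longleftrightarrow>
     (\<forall>i. (\<lambda>z. y z $ i) analytic_on Pi_minus) \<and>
     (\<forall>z\<in>Pi_minus. Bmat *v (\<chi> i. deriv (\<lambda>w. y w $ i) z) + Q0 \<mu> z *v y z = y z)"

text \<open>
  The estimates are required on the open cut plane only. They pass to the boundary values on the
  relevant side of the cut by taking limits, so nothing is lost by not mentioning these values.
\<close>

definition jost_sector :: "2 \<Rightarrow> real \<Rightarrow> complex set" where
  "jost_sector j \<delta> =
     {z \<in> Pi_minus. if j = 1 then - pi + \<delta> \<le> Arg z else Arg z \<le> pi - \<delta>}"

definition jost_solutions :: "complex \<Rightarrow> (2 \<Rightarrow> complex \<Rightarrow> complex ^ 2) \<Rightarrow> bool" where
  "jost_solutions \<mu> e \<longleftrightarrow>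
     (\<forall>j. model_solution \<mu> (e j) \<and>
        (\<forall>\<delta>\<in>{0<..<pi}. \<exists>K r. \<forall>z\<in>jost_sector j \<delta>. cmod z \<ge> r \<longrightarrow>
           norm (exp (- R_j j * z) *s e j z - vector [R_j j, 1]) \<le> K / cmod z))"

definition emat :: "(2 \<Rightarrow> complex \<Rightarrow> complex ^ 2) \<Rightarrow> complex \<Rightarrow> complex ^ 2 ^ 2" where
  "emat e z = of_cols (\<lambda>j. e j z)"


section \<open>The solutions S\<close>

definition Smat ::
  "complex \<Rightarrow> (2 \<Rightarrow> real \<Rightarrow> complex \<Rightarrow> complex ^ 2) \<Rightarrow> real \<Rightarrow> complex \<Rightarrow> complex ^ 2 ^ 2" where
  "Smat \<mu> Shat x lam = of_cols (\<lambda>j. (of_real x powr mu_j \<mu> j) *s Shat j x lam)"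

definition S_volterra ::
  "complex \<Rightarrow> (2 \<Rightarrow> complex) \<Rightarrow> (real \<Rightarrow> complex) \<Rightarrow> (real \<Rightarrow> complex) \<Rightarrow>
     2 \<Rightarrow> complex \<Rightarrow> (real \<Rightarrow> complex ^ 2) \<Rightarrow> bool" where
  "S_volterra \<mu> c0 q1 q2 j lam s \<longleftrightarrow>
     (\<forall>b>0. bounded (s ` {0<..b})) \<and>
     (\<forall>x>0.
        let f = (\<lambda>t. (of_real (t / x) powr mu_j \<mu> j) *s
                   ((Clam \<mu> c0 x lam ** matrix_inv (Clam \<mu> c0 t lam) ** Bmat ** Qpot q1 q2 t) *v s t))
        in f absolutely_integrable_on {0<..<x} \<and>
           s x = column j (Chat \<mu> c0 (of_real x * lam)) + integral {0<..<x} f)"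

definition S_solutions ::
  "complex \<Rightarrow> (2 \<Rightarrow> complex) \<Rightarrow> (real \<Rightarrow> complex) \<Rightarrow> (real \<Rightarrow> complex) \<Rightarrow>
     complex \<Rightarrow> (2 \<Rightarrow> real \<Rightarrow> complex \<Rightarrow> complex ^ 2) \<Rightarrow> bool" where
  "S_solutions \<mu> c0 q1 q2 lam Shat \<longleftrightarrow>
     fundamental_matrix_D \<mu> q1 q2 lam (\<lambda>x. Smat \<mu> Shat x lam) \<and>
     (\<forall>j. S_volterra \<mu> c0 q1 q2 j lam (\<lambda>x. Shat j x lam))"


section \<open>The Birkhoff-type solutions E\<close>

definition lam_sector :: "complex set" where
  "lam_sector = {lam. 0 < Arg lam \<and> Arg lam \<le> pi / 2}"

definition a_lam :: "complex \<Rightarrow> complex \<Rightarrow> real" where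
  "a_lam \<mu> lam = 2 * cmod \<mu> / cmod lam"

definition Fj :: "complex \<Rightarrow> 2 \<Rightarrow> complex \<Rightarrow> complex" where
  "Fj \<mu> j z = (if cmod z < 2 * cmod \<mu> then z powr (- \<mu>) else exp (R_j j * z))"

definition Fmat :: "complex \<Rightarrow> complex \<Rightarrow> complex ^ 2 ^ 2" where
  "Fmat \<mu> z = diag (\<lambda>j. Fj \<mu> j z)"

definition U0mat ::
  "complex \<Rightarrow> (2 \<Rightarrow> complex \<Rightarrow> complex ^ 2) \<Rightarrow> real \<Rightarrow> complex \<Rightarrow> complex ^ 2 ^ 2" where
  "U0mat \<mu> e x lam = emat e (of_real x * lam) ** matrix_inv (Fmat \<mu> (of_real x * lam))"

definition Qlam :: "complex \<Rightarrow> real \<Rightarrow> complex \<Rightarrow> complex ^ 2 ^ 2" where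
  "Qlam \<mu> x lam = Q0 \<mu> (of_real x) - mat lam"

definition Lmat ::
  "complex \<Rightarrow> (real \<Rightarrow> complex) \<Rightarrow> (real \<Rightarrow> complex) \<Rightarrow> real \<Rightarrow> complex \<Rightarrow> complex ^ 2 ^ 2" where
  "Lmat \<mu> q1 q2 t lam =
     (let Q = Qpot q1 q2 t; Ql = Qlam \<mu> t lam
      in vector_derivative (\<lambda>s. matrix_inv (Qlam \<mu> s lam) ** Qpot q1 q2 s) (at t) +
         matrix_inv Ql ** (Q ** Bmat ** Q + Q ** Bmat ** Ql + Ql ** Bmat ** Q))"

definition Nmat :: "complex \<Rightarrow> real \<Rightarrow> real \<Rightarrow> complex \<Rightarrow> complex ^ 2 ^ 2" where
  "Nmat \<mu> x t lam =
     (let F1 = (\<lambda>s::real. Fj \<mu> 1 (of_real s * lam)); F2 = (\<lambda>s::real. Fj \<mu> 2 (of_real s * lam))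
      in ((F2 t)\<^sup>2 * F1 x / F2 x) *m B1mat + (F1 t * F2 t) *m B2mat)"

text \<open>
  Each predicate demands the absolute convergence of exactly those integrals that occur in the
  equation at the point x. \<open>V\<close>, \<open>W\<close> and \<open>P\<close> abbreviate the vectors
  U0T(t) Q(t) u(t), U0T(t) B L(t) u(t) and Q(t,lambda)^(-1) Q(t) u(t).
\<close>

definition U1_equation ::
  "complex \<Rightarrow> (real \<Rightarrow> complex) \<Rightarrow> (real \<Rightarrow> complex) \<Rightarrow> (2 \<Rightarrow> complex \<Rightarrow> complex ^ 2) \<Rightarrow>
     complex \<Rightarrow> (real \<Rightarrow> complex ^ 2) \<Rightarrow> bool" where
  "U1_equation \<mu> q1 q2 e lam u \<longleftrightarrow>
    (let a = a_lam \<mu> lam;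
         F1 = (\<lambda>s::real. Fj \<mu> 1 (of_real s * lam));
         F2 = (\<lambda>s::real. Fj \<mu> 2 (of_real s * lam));
         U0 = (\<lambda>t. U0mat \<mu> e t lam);
         V = (\<lambda>t. (transpose (U0 t) ** Qpot q1 q2 t) *v u t);
         W = (\<lambda>t. (transpose (U0 t) ** Bmat ** Lmat \<mu> q1 q2 t lam) *v u t);
         P = (\<lambda>t. (matrix_inv (Qlam \<mu> t lam) ** Qpot q1 q2 t) *v u t)
     in
     (\<forall>x\<ge>a.
        (\<lambda>t. (F1 t * F2 t) *s V t) absolutely_integrable_on {0<..<a} \<and>
        (\<lambda>t. (F1 t * F2 t) *s W t) absolutely_integrable_on {a<..<x} \<and>
        (\<lambda>t. ((F1 t)\<^sup>2 * (F2 x / F1 x)) *s W t) absolutely_integrable_on {x<..} \<and>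
        u x = column 1 (U0 x) - (1/2) *s P x +
          (1 / (2 * \<i>)) *s (U0 x *v
            (B1mat *v integral {0<..<a} (\<lambda>t. (F1 t * F2 t) *s V t)
             - (1/2) *s (B1mat *v integral {a<..<x} (\<lambda>t. (F1 t * F2 t) *s W t))
             + (1/2) *s (B2mat *v integral {x<..} (\<lambda>t. ((F1 t)\<^sup>2 * (F2 x / F1 x)) *s W t))
             - (1/2) *s (B1mat *v ((F1 a * F2 a) *s ((transpose (U0 a) ** Bmat) *v P a)))))) \<and>
     (\<forall>x. 0 < x \<and> x < a \<longrightarrow>
        (\<lambda>t. (F1 t * F2 t) *s V t) absolutely_integrable_on {0<..<x} \<and>
        (\<lambda>t. (F1 t)\<^sup>2 *s V t) absolutely_integrable_on {x<..<a} \<and>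
        (\<lambda>t. (F1 t)\<^sup>2 *s W t) absolutely_integrable_on {a<..} \<and>
        u x = column 1 (U0 x) +
          (1 / (2 * \<i>)) *s (U0 x *v
            (B1mat *v integral {0<..<x} (\<lambda>t. (F1 t * F2 t) *s V t)
             - B2mat *v integral {x<..<a} (\<lambda>t. (F1 t)\<^sup>2 *s V t)
             + (1/2) *s (B2mat *v integral {a<..} (\<lambda>t. (F1 t)\<^sup>2 *s W t))
             + (1/2) *s (B2mat *v ((F1 a)\<^sup>2 *s ((transpose (U0 a) ** Bmat) *v P a)))))))"

definition U2_equation ::
  "complex \<Rightarrow> (real \<Rightarrow> complex) \<Rightarrow> (real \<Rightarrow> complex) \<Rightarrow> (2 \<Rightarrow> complex \<Rightarrow> complex ^ 2) \<Rightarrow>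
     complex \<Rightarrow> (real \<Rightarrow> complex ^ 2) \<Rightarrow> bool" where
  "U2_equation \<mu> q1 q2 e lam u \<longleftrightarrow>
    (let a = a_lam \<mu> lam;
         N = (\<lambda>x t. Nmat \<mu> x t lam);
         U0 = (\<lambda>t. U0mat \<mu> e t lam);
         V = (\<lambda>t. (transpose (U0 t) ** Qpot q1 q2 t) *v u t);
         W = (\<lambda>t. (transpose (U0 t) ** Bmat ** Lmat \<mu> q1 q2 t lam) *v u t);
         P = (\<lambda>t. (matrix_inv (Qlam \<mu> t lam) ** Qpot q1 q2 t) *v u t)
     in
     (\<forall>x\<ge>a.
        (\<lambda>t. N x t *v V t) absolutely_integrable_on {0<..<a} \<and>
        (\<lambda>t. N x t *v W t) absolutely_integrable_on {a<..<x} \<and>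
        u x = column 2 (U0 x) - (1/2) *s P x +
          (1 / (2 * \<i>)) *s (U0 x *v
            (integral {0<..<a} (\<lambda>t. N x t *v V t)
             - (1/2) *s integral {a<..<x} (\<lambda>t. N x t *v W t)
             - (1/2) *s (N x a *v ((transpose (U0 a) ** Bmat) *v P a))))) \<and>
     (\<forall>x. 0 < x \<and> x < a \<longrightarrow>
        (\<lambda>t. N x t *v V t) absolutely_integrable_on {0<..<x} \<and>
        u x = column 2 (U0 x) +
          (1 / (2 * \<i>)) *s (U0 x *v integral {0<..<x} (\<lambda>t. N x t *v V t))))"

definition nu :: "complex \<Rightarrow> real" where
  "nu \<mu> = min 1 (2 * Re \<mu>)"

text \<open>
  \<open>birkhoff_U \<mu> q1 q2 e R U\<close>: for all \<open>lam\<close> of the sector with \<open>\<bar>lam\<bar> \<ge> R\<close> the functions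
  \<open>U 1\<close>, \<open>U 2\<close> are the bounded solutions of their equations, with the uniform estimate.
\<close>

definition birkhoff_U ::
  "complex \<Rightarrow> (real \<Rightarrow> complex) \<Rightarrow> (real \<Rightarrow> complex) \<Rightarrow> (2 \<Rightarrow> complex \<Rightarrow> complex ^ 2) \<Rightarrow>
     real \<Rightarrow> (2 \<Rightarrow> real \<Rightarrow> complex \<Rightarrow> complex ^ 2) \<Rightarrow> bool" where
  "birkhoff_U \<mu> q1 q2 e R U \<longleftrightarrow>
     (\<forall>lam\<in>lam_sector. cmod lam \<ge> R \<longrightarrow>
        (\<forall>j. bounded ((\<lambda>x. U j x lam) ` {0<..})) \<and>
        U1_equation \<mu> q1 q2 e lam (\<lambda>x. U 1 x lam) \<and>
        U2_equation \<mu> q1 q2 e lam (\<lambda>x. U 2 x lam)) \<and>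
     (\<exists>M. \<forall>lam\<in>lam_sector. cmod lam \<ge> R \<longrightarrow>
        (\<forall>j. \<forall>x>0. norm (U j x lam - column j (U0mat \<mu> e x lam)) \<le> M * cmod lam powr (- nu \<mu>)))"

definition Emat ::
  "complex \<Rightarrow> (2 \<Rightarrow> real \<Rightarrow> complex \<Rightarrow> complex ^ 2) \<Rightarrow> real \<Rightarrow> complex \<Rightarrow> complex ^ 2 ^ 2" where
  "Emat \<mu> U x lam = of_cols (\<lambda>j. U j x lam) ** Fmat \<mu> (of_real x * lam)"

end

theory Submission
  imports Defs
begin

text \<open>
  The two sets of solutions are compared through the integral equations that they satisfy near
  the origin, for \<open>0 < x < a\<^sub>\<lambda>\<close>. Since \<open>e\<close> has Wronskian \<open>2 \<i>\<close> (\<open>det_emat\<close>) and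
  \<open>T B T\<^sup>T = det T \<cdot> B\<close> for two-by-two matrices, the kernel \<open>C(x, \<lambda>) C(t, \<lambda>)\<inverse> B\<close> of the Volterra
  equation for \<open>S\<close> equals \<open>1 / (2 \<i>) e(x \<lambda>) B e(t \<lambda>)\<^sup>T\<close> (\<open>Clam_kernel\<close>), which is the kernel in the
  equations for \<open>E = U F\<close>. So \<open>E\<close> and \<open>S \<gamma>\<close>, being the same function, satisfy an equation of the form

    \<open>y(x) = (model part) + 1 / (2 \<i>) e(x \<lambda>) B \<integral> e(t \<lambda>)\<^sup>T Q(t) y(t) dt\<close>, the integral from 0 to \<open>x\<close>,

  with the same integral, and their model parts must coincide. The model part of \<open>S \<gamma>\<close> is
  \<open>C(x, \<lambda>) \<gamma> = C(x \<lambda>) diag(\<lambda>\<^bsup>-\<mu>\<^sub>j\<^esup>) \<gamma>\<close> (\<open>S_combination_has_integral\<close>).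

  The model part of \<open>E\<^sub>2\<close> is \<open>e\<^sub>2 = C \<gamma>\<^sup>0\<^sub>2\<close> (\<open>U2_inner\<close>), and the first claim follows at once. The model
  part of \<open>E\<^sub>1\<close> is \<open>e\<^sub>1 + \<kappa> e\<^sub>2\<close> with a number \<open>\<kappa> = \<kappa>(\<lambda>)\<close> that collects the terms of the
  equation that are constant in \<open>x\<close> (\<open>U1_inner\<close>), whence \<open>\<gamma>\<^sub>j\<^sub>1 = \<lambda>\<^bsup>\<mu>\<^sub>j\<^esup> (\<gamma>\<^sup>0\<^sub>j\<^sub>1 + \<kappa> \<gamma>\<^sup>0\<^sub>j\<^sub>2)\<close>.

  It remains to see that \<open>\<kappa> = O(|\<lambda>|\<^bsup>-\<nu>\<^esup>)\<close> and that one may divide by \<open>\<gamma>\<^sup>0\<^sub>j\<^sub>1\<close>. For the first, let \<open>x\<close>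
  tend to 0 in the bound \<open>|U\<^sub>1 - U\<^sub>1\<^sup>0| \<le> M |\<lambda>|\<^bsup>-\<nu>\<^esup>\<close>: the left side tends to a nonzero constant times
  \<open>|\<kappa>|\<close> (\<open>extra_coefficient_bound\<close>). For the second, and for the constant just mentioned, no entry of
  \<open>\<gamma>\<^sup>0\<close> vanishes (\<open>connection_coefficient_nonzero\<close>): up to its power factor each column of \<open>C\<close> has
  entries that are even or odd in \<open>z\<close>, while each \<open>e\<^sub>k\<close> grows in one direction of the imaginary axis
  and decays in the other.
\<close>

section \<open>Two-by-two matrices\<close>

lemmas entrywise = vec_eq_iff forall_2 sum_2 matrix_matrix_mult_def matrix_vector_mult_def
  transpose_def cscale_def mat_def column_def diag_def of_cols_def

lemma cscale_matrix_mult: "A ** (c *m B) = c *m (A ** B)" "(c *m A) ** B = c *m (A ** B)"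
  by (simp_all add: entrywise algebra_simps)

lemma cscale_cscale: "c *m (d *m A) = (c * d) *m A"
  by (simp add: cscale_def vec_eq_iff)

lemma cscale_mult_vec: "(c *m A) *v v = c *s (A *v v)"
  by (simp add: entrywise algebra_simps)

lemma transpose_cscale: "transpose (c *m A) = c *m transpose A"
  by (simp add: entrywise)

text \<open>
  The matrix \<open>B\<close> is the symplectic form of the plane, and every two-by-two matrix preserves it up to
  its determinant.
\<close>

lemma matrix_times_B_transpose: "T ** (Bmat ** transpose T) = det T *m Bmat"
  by (simp add: entrywise Bmat_def det_2 algebra_simps)

lemma matrix_inv_mult:
  fixes T :: "complex ^ 2 ^ 2"
  assumes "det T \<noteq> 0"
  shows "matrix_inv T ** T = mat 1" "T ** matrix_inv T = mat 1"
proof -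
  have "\<exists>A. T ** A = mat 1 \<and> A ** T = mat 1"
    using assms by (metis invertible_def invertible_det_nz)
  then have "T ** matrix_inv T = mat 1 \<and> matrix_inv T ** T = mat 1"
    unfolding matrix_inv_def by (rule someI_ex)
  then show "matrix_inv T ** T = mat 1" "T ** matrix_inv T = mat 1" by auto
qed

lemma matrix_inv_times_B:
  assumes "det T \<noteq> 0"
  shows "matrix_inv T ** Bmat = (1 / det T) *m (Bmat ** transpose T)"
proof -
  have "Bmat = T ** ((1 / det T) *m (Bmat ** transpose T))"
    using assms by (simp add: cscale_matrix_mult matrix_times_B_transpose cscale_cscale)
      (simp add: cscale_def)
  then have "matrix_inv T ** Bmat = matrix_inv T ** (T ** ((1 / det T) *m (Bmat ** transpose T)))"
    by simp
  also have "\<dots> = (1 / det T) *m (Bmat ** transpose T)"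
    using matrix_inv_mult[OF assms] by (simp add: matrix_mul_assoc)
  finally show ?thesis .
qed

text \<open>
  Two fundamental matrices of one system differ by a constant right factor \<open>G\<close>, and the factor cancels
  in \<open>X G (Y G)\<inverse>\<close>. This is why the Volterra kernel built from \<open>C\<close> and the kernel with
  \<open>1 / (2 \<i>)\<close> in the equations for \<open>U\<close> are the same one.
\<close>

lemma cauchy_kernel_times_B:
  assumes "det Y \<noteq> 0" "det G \<noteq> 0"
  shows "(X ** G) ** matrix_inv (Y ** G) ** Bmat = (1 / det Y) *m (X ** (Bmat ** transpose Y))"
proof -
  have "(X ** G) ** matrix_inv (Y ** G) ** Bmat = (X ** G) ** (matrix_inv (Y ** G) ** Bmat)"
    by (simp add: matrix_mul_assoc)
  also have "\<dots> = (X ** G) ** ((1 / (det Y * det G)) *m (Bmat ** transpose (Y ** G)))"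
    using assms by (subst matrix_inv_times_B) (simp_all add: det_mul)
  also have "\<dots> = (1 / (det Y * det G)) *m (X ** ((G ** (Bmat ** transpose G)) ** transpose Y))"
    by (simp add: cscale_matrix_mult matrix_transpose_mul matrix_mul_assoc)
  also have "\<dots> = (1 / det Y) *m (X ** (Bmat ** transpose Y))"
    using assms unfolding matrix_times_B_transpose by (simp add: cscale_matrix_mult cscale_cscale)
  finally show ?thesis .
qed

section \<open>The power series of the model system\<close>

lemma summable_bessel_type:
  fixes f :: "nat \<Rightarrow> complex"
  assumes rec: "\<And>k. f (Suc k) = - f k / (2 * of_nat (Suc k) * (b + 2 * of_nat k))"
  shows "summable (\<lambda>k. f k * w ^ k)"
proof (rule summable_ratio_test)
  let ?N = "nat \<lceil>cmod w + cmod b + 1\<rceil>"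
  \<comment> \<open>From this index on the last factor of the denominator is at least 1 in modulus, and
    \<open>k\<close> exceeds \<open>cmod w\<close>, so the ratio is at most one half.\<close>
  fix k assume "k \<ge> ?N"
  then have k: "real k \<ge> cmod w + cmod b + 1" by linarith
  have "2 * real k \<le> cmod (b + 2 * of_nat k) + cmod b"
    using norm_triangle_ineq4[of "b + 2 * of_nat k" b] by (simp add: norm_mult)
  moreover have "real k \<ge> 1 + cmod w" "real k \<ge> cmod b + 1"
    using k norm_ge_zero[of w] norm_ge_zero[of b] by linarith+
  ultimately have 1: "cmod (b + 2 * of_nat k) \<ge> 1" by linarith
  have "2 * cmod w * 1 \<le> 2 * real (Suc k) * cmod (b + 2 * of_nat k)"
    using 1 \<open>real k \<ge> 1 + cmod w\<close> by (intro mult_mono) auto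
  moreover have "0 < 2 * real (Suc k) * cmod (b + 2 * of_nat k)"
    using 1 by (intro mult_pos_pos) linarith+
  ultimately have le: "cmod w / (2 * real (Suc k) * cmod (b + 2 * of_nat k)) \<le> 1 / 2"
    by (simp add: pos_divide_le_eq del: of_nat_Suc)
  have "norm (f (Suc k) * w ^ Suc k)
      = norm (f k * w ^ k) * (cmod w / (2 * real (Suc k) * cmod (b + 2 * of_nat k)))"
    unfolding rec by (simp add: norm_mult norm_divide norm_power del: of_nat_Suc)
  also have "\<dots> \<le> norm (f k * w ^ k) * (1 / 2)"
    by (intro mult_left_mono le) auto
  finally show "norm (f (Suc k) * w ^ Suc k) \<le> 1 / 2 * norm (f k * w ^ k)" by simp
qed simp

definition even_series :: "complex \<Rightarrow> (2 \<Rightarrow> complex) \<Rightarrow> 2 \<Rightarrow> complex \<Rightarrow> complex" where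
  "even_series \<mu> c0 j w = (\<Sum>k. c_even \<mu> c0 j k * w ^ k)"

definition odd_series :: "complex \<Rightarrow> (2 \<Rightarrow> complex) \<Rightarrow> 2 \<Rightarrow> complex \<Rightarrow> complex" where
  "odd_series \<mu> c0 j w = (\<Sum>k. c_odd \<mu> c0 j k * w ^ k)"

text \<open>
  The step from one coefficient to the next, common to the even and the odd coefficients: \<open>n\<close> and \<open>d\<close>
  are the new factors of the factorial and of the product in the denominator.
\<close>

lemma bessel_type_step:
  fixes m :: complex
  shows "(- 1 * m) * c / ((2 * p) * (n * f) * (P * d)) = - (m * c / (p * f * P)) / (2 * n * d)"
  by (simp add: divide_simps)

lemma summable_c_even: "summable (\<lambda>k. c_even \<mu> c0 j k * w ^ k)"
  by (rule summable_bessel_type[where b = "2 * mu_j \<mu> j + 1"])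
     (unfold c_even_def power_Suc fact_Suc prod.lessThan_Suc, rule bessel_type_step)

lemma summable_c_odd: "summable (\<lambda>k. c_odd \<mu> c0 j k * w ^ k)"
proof (rule summable_bessel_type[where b = "2 * mu_j \<mu> j + 3"])
  fix k
  have last: "2 * mu_j \<mu> j + 1 + 2 * of_nat (Suc k) = 2 * mu_j \<mu> j + 3 + 2 * of_nat k" by simp
  show "c_odd \<mu> c0 j (Suc k)
      = - c_odd \<mu> c0 j k / (2 * of_nat (Suc k) * (2 * mu_j \<mu> j + 3 + 2 * of_nat k))"
    unfolding c_odd_def power_Suc fact_Suc prod.atMost_Suc last by (rule bessel_type_step)
qed

lemma sums_matrixI:
  fixes f :: "nat \<Rightarrow> complex ^ 2 ^ 2"
  assumes "\<And>i j. (\<lambda>k. f k $ i $ j) sums (S $ i $ j)"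
  shows "f sums S"
  using assms unfolding sums_def by (intro vec_tendstoI) (simp add: sum_component)

lemma Chat_eq:
  "Chat \<mu> c0 z = vector [vector [z * odd_series \<mu> c0 1 (z\<^sup>2), even_series \<mu> c0 2 (z\<^sup>2)],
                        vector [- even_series \<mu> c0 1 (z\<^sup>2), z * odd_series \<mu> c0 2 (z\<^sup>2)]]"
proof -
  have ev: "(\<lambda>k. c_even \<mu> c0 j k * (z\<^sup>2) ^ k) sums even_series \<mu> c0 j (z\<^sup>2)" for j
    unfolding even_series_def by (rule summable_sums[OF summable_c_even])
  have od: "(\<lambda>k. c_odd \<mu> c0 j k * (z\<^sup>2) ^ k) sums odd_series \<mu> c0 j (z\<^sup>2)" for j
    unfolding odd_series_def by (rule summable_sums[OF summable_c_odd])
  have ev': "(\<lambda>k. z ^ (2 * k) * c_even \<mu> c0 j k) sums even_series \<mu> c0 j (z\<^sup>2)" for j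
    using ev[of j] unfolding mult.commute[of "c_even _ _ _ _"] power_mult[symmetric] .
  have od': "(\<lambda>k. z ^ (2 * k) * (z * c_odd \<mu> c0 j k)) sums (z * odd_series \<mu> c0 j (z\<^sup>2))" for j
    using sums_mult[OF od[of j], of z] unfolding power_mult by (simp add: mult_ac)
  have "\<forall>i j. (\<lambda>k. (z ^ (2 * k) *m
        vector [vector [z * c_odd \<mu> c0 1 k, c_even \<mu> c0 2 k],
                vector [- c_even \<mu> c0 1 k, z * c_odd \<mu> c0 2 k]]) $ i $ j) sums
     ((vector [vector [z * odd_series \<mu> c0 1 (z\<^sup>2), even_series \<mu> c0 2 (z\<^sup>2)],
              vector [- even_series \<mu> c0 1 (z\<^sup>2), z * odd_series \<mu> c0 2 (z\<^sup>2)]]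
        :: complex ^ 2 ^ 2) $ i $ j)"
    unfolding forall_2 cscale_def vec_lambda_beta vector_2 mult_minus_right
    by (intro conjI; (rule od' ev' sums_minus[OF ev'])?)
  then have "(\<lambda>k. z ^ (2 * k) *m
        vector [vector [z * c_odd \<mu> c0 1 k, c_even \<mu> c0 2 k],
                vector [- c_even \<mu> c0 1 k, z * c_odd \<mu> c0 2 k]]) sums
     vector [vector [z * odd_series \<mu> c0 1 (z\<^sup>2), even_series \<mu> c0 2 (z\<^sup>2)],
             vector [- even_series \<mu> c0 1 (z\<^sup>2), z * odd_series \<mu> c0 2 (z\<^sup>2)]]"
    by (intro sums_matrixI) iprover
  then show ?thesis
    unfolding Chat_def by (rule sums_unique[symmetric])
qed

lemma even_series_0: "even_series \<mu> c0 j 0 = c0 j"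
proof -
  have "even_series \<mu> c0 j 0 = c_even \<mu> c0 j 0"
    unfolding even_series_def using powser_zero by simp
  then show ?thesis by (simp add: c_even_def)
qed

lemma isCont_even_series: "isCont (even_series \<mu> c0 j) w"
  unfolding even_series_def by (rule isCont_powser_converges_everywhere[OF summable_c_even])

lemma isCont_odd_series: "isCont (odd_series \<mu> c0 j) w"
  unfolding odd_series_def by (rule isCont_powser_converges_everywhere[OF summable_c_odd])

lemma norm_Chat_minus: "cmod (Chat \<mu> c0 (- z) $ 2 $ j) = cmod (Chat \<mu> c0 z $ 2 $ j)"
proof -
  have "\<forall>j. cmod (Chat \<mu> c0 (- z) $ 2 $ j) = cmod (Chat \<mu> c0 z $ 2 $ j)"
    unfolding forall_2 by (simp add: Chat_eq)
  then show ?thesis by blast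
qed

section \<open>The solutions with exponential asymptotics\<close>

text \<open>
  Both halves of the imaginary axis (\<open>s = \<plusminus>1\<close>) lie in both sectors for \<open>\<delta> = \<pi> / 2\<close>, so there both
  asymptotic formulas are available at once.
\<close>

lemma jost_imaginary_axis:
  fixes s :: real
  assumes "jost_solutions \<mu> e" "s = 1 \<or> s = -1"
  shows "((\<lambda>y. exp (- R_j j * (\<i> * of_real (s * y))) * e j (\<i> * of_real (s * y)) $ i)
            \<longlongrightarrow> vector [R_j j, 1] $ i) at_top"
proof -
  have "pi / 2 \<in> {0<..<pi}" by auto
  with assms(1) obtain K r where
    K: "\<And>z. z \<in> jost_sector j (pi / 2) \<Longrightarrow> cmod z \<ge> r \<Longrightarrow>
         norm (exp (- R_j j * z) *s e j z - vector [R_j j, 1]) \<le> K / cmod z"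
    unfolding jost_solutions_def by blast
  have sector: "\<i> * of_real (s * y) \<in> jost_sector j (pi / 2)" if "y > 0" for y
  proof -
    have "Arg (\<i> * of_real (s * y)) = s * pi / 2"
      using assms(2)
    proof
      assume "s = 1"
      then show ?thesis using \<open>y > 0\<close> Arg_times_of_real2[of y "\<i>"] by simp
    next
      assume "s = -1"
      then show ?thesis using \<open>y > 0\<close> Arg_times_of_real2[of y "-\<i>"] by simp
    qed
    with that assms(2) show ?thesis
      by (auto simp: jost_sector_def Pi_minus_def)
  qed
  have "((\<lambda>y. exp (- R_j j * (\<i> * of_real (s * y))) * e j (\<i> * of_real (s * y)) $ i
             - vector [R_j j, 1] $ i) \<longlongrightarrow> 0) at_top"
  proof (rule Lim_null_comparison)
    show "((\<lambda>y. K / y) \<longlongrightarrow> 0) at_top"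
      by (rule tendsto_divide_0[OF tendsto_const filterlim_at_top_imp_at_infinity[OF filterlim_ident]])
    show "\<forall>\<^sub>F y in at_top. norm (exp (- R_j j * (\<i> * of_real (s * y))) * e j (\<i> * of_real (s * y)) $ i
             - vector [R_j j, 1] $ i) \<le> K / y"
      using eventually_gt_at_top[of "max 0 r"]
    proof eventually_elim
      case (elim y)
      let ?z = "\<i> * complex_of_real (s * y)"
      have y: "cmod ?z = y" using elim assms(2) by (auto simp: norm_mult)
      have "norm ((exp (- R_j j * ?z) *s e j ?z - vector [R_j j, 1]) $ i) \<le> K / cmod ?z"
      proof (rule order_trans[OF Finite_Cartesian_Product.norm_nth_le K])
        show "?z \<in> jost_sector j (pi / 2)" using elim by (intro sector) simp
        show "r \<le> cmod ?z" using elim unfolding y by simp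
      qed
      then show ?case unfolding y by simp
    qed
  qed
  then show ?thesis by (simp add: LIM_zero_iff)
qed

lemma model_solution_derivative:
  assumes "model_solution \<mu> y" "z \<in> Pi_minus"
  shows "((\<lambda>w. y w $ 1) has_field_derivative (\<mu> / z * y z $ 1 - y z $ 2)) (at z)"
    and "((\<lambda>w. y w $ 2) has_field_derivative (y z $ 1 - \<mu> / z * y z $ 2)) (at z)"
proof -
  have deriv: "((\<lambda>w. y w $ i) has_field_derivative deriv (\<lambda>w. y w $ i) z) (at z)" for i
    using assms analytic_on_imp_differentiable_at
    unfolding model_solution_def DERIV_deriv_iff_field_differentiable by blast
  have eq: "Bmat *v (\<chi> i. deriv (\<lambda>w. y w $ i) z) + Q0 \<mu> z *v y z = y z"
    using assms unfolding model_solution_def by blast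
  have "- deriv (\<lambda>w. y w $ 1) z + \<mu> / z * y z $ 1 = y z $ 2"
    using arg_cong[OF eq, of "\<lambda>v. v $ 2"]
    by (simp add: matrix_vector_mult_def sum_2 cscale_def Bmat_def Q0_def Jmat_def)
  then have "deriv (\<lambda>w. y w $ 1) z = \<mu> / z * y z $ 1 - y z $ 2"
    by (simp add: algebra_simps)
  with deriv[of 1] show "((\<lambda>w. y w $ 1) has_field_derivative (\<mu> / z * y z $ 1 - y z $ 2)) (at z)"
    by simp
  have "deriv (\<lambda>w. y w $ 2) z + \<mu> / z * y z $ 2 = y z $ 1"
    using arg_cong[OF eq, of "\<lambda>v. v $ 1"]
    by (simp add: matrix_vector_mult_def sum_2 cscale_def Bmat_def Q0_def Jmat_def)
  then have "deriv (\<lambda>w. y w $ 2) z = y z $ 1 - \<mu> / z * y z $ 2"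
    by (simp add: algebra_simps)
  with deriv[of 2] show "((\<lambda>w. y w $ 2) has_field_derivative (y z $ 1 - \<mu> / z * y z $ 2)) (at z)"
    by simp
qed

text \<open>
  The coefficient matrix of the model system has trace zero, so the Wronskian is constant. Its
  value comes from the asymptotics along the imaginary axis, where the two exponential factors cancel.
  The half plane is enough, since \<open>x \<lambda>\<close> lies in it for \<open>x > 0\<close> and \<open>\<lambda>\<close> in the sector, and it
  is convex.
\<close>

lemma det_emat:
  assumes "jost_solutions \<mu> e" "Im z > 0"
  shows "det (emat e z) = 2 * \<i>"
proof -
  let ?H = "{z. Im z > 0}"
  define D where "D w = e 1 w $ 1 * e 2 w $ 2 - e 2 w $ 1 * e 1 w $ 2" for w
  have D: "det (emat e w) = D w" for w
    by (simp add: D_def emat_def of_cols_def det_2)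
  have ms: "model_solution \<mu> (e j)" for j
    using assms(1) unfolding jost_solutions_def by blast
  have "\<exists>c. \<forall>w\<in>?H. D w = c"
  proof (rule has_field_derivative_zero_constant)
    show "convex ?H" by (rule convex_halfspace_Im_gt)
    fix w assume "w \<in> ?H"
    then have w: "w \<in> Pi_minus" by (auto simp: Pi_minus_def)
    have "(D has_field_derivative 0) (at w)"
      unfolding D_def
      by (rule derivative_eq_intros model_solution_derivative[OF ms w] refl)+
         (simp add: algebra_simps)
    then show "(D has_field_derivative 0) (at w within ?H)"
      by (rule has_field_derivative_at_within)
  qed
  then obtain c where c: "\<And>w. Im w > 0 \<Longrightarrow> D w = c" by auto
  let ?E = "\<lambda>j y. exp (- R_j j * (\<i> * of_real (1 * y)))"
  let ?e = "\<lambda>j i y. ?E j y * e j (\<i> * of_real (1 * y)) $ i"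
  let ?v = "\<lambda>j. vector [R_j j, 1] :: complex ^ 2"
  have lim: "((\<lambda>y. ?e 1 1 y * ?e 2 2 y - ?e 2 1 y * ?e 1 2 y) \<longlongrightarrow>
      ?v 1 $ 1 * ?v 2 $ 2 - ?v 2 $ 1 * ?v 1 $ 2) at_top"
    by (intro tendsto_diff tendsto_mult jost_imaginary_axis[OF assms(1) disjI1[OF refl]])
  have cancel: "?E 1 y * ?E 2 y = 1" for y
    by (simp add: R_j_def flip: exp_add)
  have eq: "?e 1 1 y * ?e 2 2 y - ?e 2 1 y * ?e 1 2 y = D (\<i> * of_real y)" for y
  proof -
    have "?e 1 1 y * ?e 2 2 y - ?e 2 1 y * ?e 1 2 y = (?E 1 y * ?E 2 y) * D (\<i> * of_real y)"
      unfolding D_def by (simp add: algebra_simps)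
    then show ?thesis unfolding cancel by simp
  qed
  from lim have "((\<lambda>y. D (\<i> * of_real y)) \<longlongrightarrow> 2 * \<i>) at_top"
    unfolding eq by (simp add: R_j_def)
  moreover have "((\<lambda>y. D (\<i> * of_real y)) \<longlongrightarrow> c) at_top"
    by (rule tendsto_eventually) (use eventually_gt_at_top[of 0] in eventually_elim, auto intro!: c)
  ultimately have "c = 2 * \<i>"
    using tendsto_unique trivial_limit_at_top_linorder by blast
  with c assms(2) D show ?thesis by simp
qed

lemma no_fixed_ratio:
  fixes p q :: "real \<Rightarrow> real"
  assumes "\<kappa> > 0" "\<And>y. y > 0 \<Longrightarrow> p y = \<kappa> * q y"
    and p: "((\<lambda>y. exp y * p y) \<longlongrightarrow> 1) at_top" and q: "((\<lambda>y. exp (- y) * q y) \<longlongrightarrow> 1) at_top"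
  shows False
proof -
  have e: "((\<lambda>y. exp (- y) :: real) \<longlongrightarrow> 0) at_top"
    by (rule filterlim_compose[OF exp_at_bot filterlim_uminus_at_bot_at_top])
  have "((\<lambda>y. exp (- y) * (exp (- y) * (exp y * p y))) \<longlongrightarrow> 0 * (0 * 1)) at_top"
    by (intro tendsto_mult e p)
  moreover have "\<forall>\<^sub>F y in at_top. exp (- y) * (exp (- y) * (exp y * p y)) = \<kappa> * (exp (- y) * q y)"
    using eventually_gt_at_top[of 0]
  proof eventually_elim
    case (elim y)
    have "exp (- y) * (exp (- y) * (exp y * p y)) = exp (- y) * p y"
      by (simp add: exp_minus)
    also have "\<dots> = \<kappa> * (exp (- y) * q y)" using assms(2)[OF elim] by simp
    finally show ?case .
  qed
  ultimately have "((\<lambda>y. \<kappa> * (exp (- y) * q y)) \<longlongrightarrow> 0 * (0 * 1)) at_top"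
    by (rule Lim_transform_eventually)
  moreover have "((\<lambda>y. \<kappa> * (exp (- y) * q y)) \<longlongrightarrow> \<kappa> * 1) at_top"
    by (intro tendsto_mult tendsto_const q)
  ultimately have "0 * (0 * 1) = \<kappa> * 1"
    by (rule tendsto_unique[OF trivial_limit_at_top_linorder])
  with \<open>\<kappa> > 0\<close> show False by simp
qed

text \<open>
  If a coefficient vanished, \<open>e\<^sub>k\<close> would be a multiple of a single column of \<open>C\<close>. Up to its power
  factor such a column is even or odd in each entry, so its size at \<open>\<i> y\<close> and at \<open>- \<i> y\<close> would have a
  ratio independent of \<open>y\<close>; but \<open>e\<^sub>k\<close> decays exponentially along one of these two rays and grows
  along the other.
\<close>

lemma connection_coefficient_nonzero:
  assumes jost: "jost_solutions \<mu> e"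
    and conn: "\<And>z. z \<in> Pi_minus \<Longrightarrow> emat e z = Cmodel \<mu> c0 z ** \<gamma>0"
  shows "\<gamma>0 $ j $ k \<noteq> 0"
proof
  assume zero: "\<gamma>0 $ j $ k = 0"
  obtain j' :: 2 where j': "UNIV = {j, j'}" "j \<noteq> j'"
  proof -
    have "\<forall>j::2. \<exists>j'. UNIV = {j, j'} \<and> j \<noteq> j'"
      unfolding forall_2 by (metis UNIV_2 insert_commute zero_neq_one exhaust_2)
    then show ?thesis using that by blast
  qed
  have ek: "e k z $ 2 = Chat \<mu> c0 z $ 2 $ j' * z powr mu_j \<mu> j' * \<gamma>0 $ j' $ k" if "z \<in> Pi_minus" for z
  proof -
    have "e k z $ 2 = (\<Sum>l\<in>UNIV. Cmodel \<mu> c0 z $ 2 $ l * \<gamma>0 $ l $ k)"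
      using arg_cong[OF conn[OF that], of "\<lambda>A. A $ 2 $ k"]
      by (simp add: emat_def of_cols_def matrix_matrix_mult_def)
    also have "\<dots> = Cmodel \<mu> c0 z $ 2 $ j' * \<gamma>0 $ j' $ k"
      unfolding j'(1) using j'(2) zero by simp
    also have "Cmodel \<mu> c0 z $ 2 $ j' = Chat \<mu> c0 z $ 2 $ j' * z powr mu_j \<mu> j'"
      by (simp add: Cmodel_def matrix_matrix_mult_def diag_def if_distrib sum.delta cong: if_cong)
    finally show ?thesis .
  qed
  let ?m = "mu_j \<mu> j'"
  define p where "p y = cmod (e k (\<i> * of_real (1 * y)) $ 2)" for y
  define q where "q y = cmod (e k (\<i> * of_real (-1 * y)) $ 2)" for y
  \<comment> \<open>The modulus of \<open>z powr ?m\<close> depends on \<open>Arg z = \<plusminus> \<pi> / 2\<close> only through this ratio.\<close>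
  define \<kappa> where "\<kappa> = exp (- Im ?m * pi / 2) / exp (Im ?m * pi / 2)"
  have pq: "p y = \<kappa> * q y" if "y > 0" for y
  proof -
    have "\<i> * of_real y \<in> Pi_minus" "- (\<i> * of_real y) \<in> Pi_minus"
      using that by (auto simp: Pi_minus_def)
    moreover have arg: "Arg (\<i> * of_real y) = pi / 2" "Arg (- (\<i> * of_real y)) = - pi / 2"
      using that Arg_times_of_real2[of y "\<i>"] Arg_times_of_real2[of y "-\<i>"] by simp_all
    moreover have
      "cmod ((\<i> * of_real y) powr ?m) = y powr Re ?m * exp (- Im ?m * pi / 2)"
      "cmod ((- (\<i> * of_real y)) powr ?m) = y powr Re ?m * exp (Im ?m * pi / 2)"
      unfolding norm_powr_complex arg by (simp_all add: norm_mult that less_imp_le)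
    ultimately show ?thesis
      unfolding p_def q_def \<kappa>_def
      by (simp add: ek norm_mult norm_Chat_minus)
  qed
  have "((\<lambda>y. cmod (exp (- R_j k * (\<i> * of_real (1 * y))) * e k (\<i> * of_real (1 * y)) $ 2))
            \<longlongrightarrow> cmod ((vector [R_j k, 1] :: complex ^ 2) $ 2)) at_top"
    by (intro tendsto_norm jost_imaginary_axis[OF jost]) simp
  then have P: "((\<lambda>y. exp (Re (- R_j k * \<i>) * y) * p y) \<longlongrightarrow> 1) at_top"
    by (simp add: norm_mult p_def mult.assoc)
  have "((\<lambda>y. cmod (exp (- R_j k * (\<i> * of_real (-1 * y))) * e k (\<i> * of_real (-1 * y)) $ 2))
            \<longlongrightarrow> cmod ((vector [R_j k, 1] :: complex ^ 2) $ 2)) at_top"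
    by (intro tendsto_norm jost_imaginary_axis[OF jost]) simp
  then have Q: "((\<lambda>y. exp (- Re (- R_j k * \<i>) * y) * q y) \<longlongrightarrow> 1) at_top"
    by (simp add: norm_mult q_def mult.assoc)
  have \<kappa>: "\<kappa> > 0" by (simp add: \<kappa>_def)
  show False
  proof (cases "k = 1")
    case True
    then show False using no_fixed_ratio[of \<kappa> p q] \<kappa> pq P Q by (simp add: R_j_def)
  next
    case False
    moreover have "q y = (1 / \<kappa>) * p y" if "y > 0" for y
      using pq[OF that] \<kappa> by simp
    ultimately show False using no_fixed_ratio[of "1 / \<kappa>" q p] \<kappa> P Q by (simp add: R_j_def)
  qed
qed

section \<open>The integral identity of the solutions S\<close>

lemma mu_j_simps [simp]: "mu_j \<mu> 1 = - \<mu>" "mu_j \<mu> 2 = \<mu>"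
  by (simp_all add: mu_j_def)

lemma upper_half_plane_Pi_minus: "Im z > 0 \<Longrightarrow> z \<in> Pi_minus"
  by (auto simp: Pi_minus_def)

lemma lam_sector_Im_pos: "lam \<in> lam_sector \<Longrightarrow> Im lam > 0"
proof -
  assume "lam \<in> lam_sector"
  then have "0 < Arg lam" "Arg lam \<le> pi / 2" by (auto simp: lam_sector_def)
  then have "0 < Arg lam \<and> Arg lam < pi" using pi_gt_zero by linarith
  then show ?thesis by (simp only: Arg_lt_pi)
qed

lemma has_integral_matrix_vector:
  fixes A :: "complex ^ 2 ^ 2"
  assumes "(f has_integral y) S"
  shows "((\<lambda>t. A *v f t) has_integral A *v y) S"
  using has_integral_linear[OF assms matrix_vector_mul_bounded_linear[of A]] by (simp add: o_def)

lemma has_integral_cscale: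
  fixes f :: "real \<Rightarrow> complex ^ 2"
  assumes "(f has_integral y) S"
  shows "((\<lambda>t. c *s f t) has_integral c *s y) S"
proof -
  have "mat c *v v = c *s v" for v :: "complex ^ 2"
    by (simp add: entrywise)
  with has_integral_matrix_vector[OF assms, of "mat c"] show ?thesis by simp
qed

lemma Clam_eq_Cmodel:
  assumes "x > 0" "lam \<noteq> 0"
  shows "Clam \<mu> c0 x lam = Cmodel \<mu> c0 (of_real x * lam) ** diag (\<lambda>j. lam powr - mu_j \<mu> j)"
proof -
  have pw: "of_real x powr m = (of_real x * lam) powr m * lam powr - m" for m
    using assms by (simp add: powr_times_real_left powr_minus)
  show ?thesis
    unfolding Clam_def Cmodel_def pw
    by (simp add: vec_eq_iff matrix_matrix_mult_def diag_def of_cols_def column_def if_distrib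
        sum.delta mult_ac cong: if_cong)
qed

text \<open>
  The vector \<open>e(t \<lambda>)\<^sup>T Q(t) y(t)\<close>. The solutions \<open>y\<close> of the Dirac system considered
  here satisfy \<open>y(x) = h(x) + 1 / (2 \<i>) e(x \<lambda>) B \<integral> e(t \<lambda>)\<^sup>T Q(t) y(t) dt\<close> with a solution \<open>h\<close> of the
  model system, the integral taken from 0 to \<open>x\<close>.
\<close>

definition Q_moment ::
  "(2 \<Rightarrow> complex \<Rightarrow> complex ^ 2) \<Rightarrow> (real \<Rightarrow> complex) \<Rightarrow> (real \<Rightarrow> complex) \<Rightarrow> complex \<Rightarrow>
    (real \<Rightarrow> complex ^ 2) \<Rightarrow> real \<Rightarrow> complex ^ 2" where
  "Q_moment e q1 q2 lam y t = transpose (emat e (of_real t * lam)) *v (Qpot q1 q2 t *v y t)"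

text \<open>
  Both fundamental matrices are products of \<open>e\<close> with the constant matrix
  \<open>\<gamma>0\<inverse> diag(\<lambda>\<^bsup>-\<mu>\<^sub>j\<^esup>)\<close>. It is invertible because the Wronskian of \<open>e\<close> does not vanish.
\<close>

lemma Clam_kernel:
  assumes jost: "jost_solutions \<mu> e"
    and conn: "\<And>z. z \<in> Pi_minus \<Longrightarrow> emat e z = Cmodel \<mu> c0 z ** \<gamma>0"
    and lam: "lam \<in> lam_sector" and "x > 0" "t > 0"
  shows "Clam \<mu> c0 x lam ** matrix_inv (Clam \<mu> c0 t lam) ** Bmat
    = (1 / (2 * \<i>)) *m (emat e (of_real x * lam) ** (Bmat ** transpose (emat e (of_real t * lam))))"
proof -
  let ?D = "diag (\<lambda>j. lam powr - mu_j \<mu> j)"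
  have Im: "Im (of_real s * lam) > 0" if "s > 0" for s
    using lam_sector_Im_pos[OF lam] that by simp
  have Pi: "of_real s * lam \<in> Pi_minus" if "s > 0" for s
    by (rule upper_half_plane_Pi_minus[OF Im[OF that]])
  have lam0: "lam \<noteq> 0" using lam_sector_Im_pos[OF lam] by auto
  have det\<gamma>: "det \<gamma>0 \<noteq> 0"
  proof
    assume "det \<gamma>0 = 0"
    then have "det (emat e (of_real t * lam)) = 0"
      using conn[OF Pi[OF \<open>t > 0\<close>]] by (simp add: det_mul)
    then show False using det_emat[OF jost Im[OF \<open>t > 0\<close>]] by simp
  qed
  have Clam: "Clam \<mu> c0 s lam = emat e (of_real s * lam) ** (matrix_inv \<gamma>0 ** ?D)" if "s > 0" for s
  proof -
    have "emat e (of_real s * lam) ** (matrix_inv \<gamma>0 ** ?D)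
        = Cmodel \<mu> c0 (of_real s * lam) ** (\<gamma>0 ** matrix_inv \<gamma>0) ** ?D"
      unfolding conn[OF Pi[OF that]] by (simp add: matrix_mul_assoc)
    then show ?thesis
      using matrix_inv_mult(2)[OF det\<gamma>] Clam_eq_Cmodel[OF that lam0] by simp
  qed
  have "det (matrix_inv \<gamma>0) \<noteq> 0"
    using arg_cong[OF matrix_inv_mult(1)[OF det\<gamma>], of det] by (auto simp: det_mul)
  moreover have "det ?D \<noteq> 0"
    using lam0 by (simp add: det_2 diag_def)
  ultimately have "det (matrix_inv \<gamma>0 ** ?D) \<noteq> 0" by (simp add: det_mul)
  moreover have det: "det (emat e (of_real t * lam)) = 2 * \<i>"
    by (rule det_emat[OF jost Im[OF \<open>t > 0\<close>]])
  ultimately show ?thesis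
    unfolding Clam[OF \<open>x > 0\<close>] Clam[OF \<open>t > 0\<close>]
    by (subst cauchy_kernel_times_B) (simp_all add: det)
qed

text \<open>
  For a combination of the columns of \<open>S\<close> the model part is the same combination of the columns of
  \<open>C(x, \<lambda>)\<close>: in the equation for the \<open>j\<close>th column the factors \<open>x\<^bsup>\<mu>\<^sub>j\<^esup>\<close> and \<open>(t / x)\<^bsup>\<mu>\<^sub>j\<^esup>\<close> combine
  to \<open>t\<^bsup>\<mu>\<^sub>j\<^esup>\<close>.
\<close>

lemma S_combination_has_integral:
  assumes jost: "jost_solutions \<mu> e"
    and conn: "\<And>z. z \<in> Pi_minus \<Longrightarrow> emat e z = Cmodel \<mu> c0 z ** \<gamma>0"
    and lam: "lam \<in> lam_sector" and x: "x > 0"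
    and S: "S_solutions \<mu> c0 q1 q2 lam Shat"
  shows "((\<lambda>t. (1 / (2 * \<i>)) *s (emat e (of_real x * lam) *v
              (Bmat *v Q_moment e q1 q2 lam (\<lambda>s. Smat \<mu> Shat s lam *v g) t)))
          has_integral (Smat \<mu> Shat x lam *v g - Clam \<mu> c0 x lam *v g)) {0<..<x}"
proof -
  let ?M = "\<lambda>t. Clam \<mu> c0 x lam ** matrix_inv (Clam \<mu> c0 t lam) ** Bmat ** Qpot q1 q2 t"
  define f where "f j t = (of_real (t / x) powr mu_j \<mu> j) *s (?M t *v Shat j t lam)" for j t
  have f: "(f j has_integral (Shat j x lam - column j (Chat \<mu> c0 (of_real x * lam)))) {0<..<x}" for j
  proof -
    have "S_volterra \<mu> c0 q1 q2 j lam (\<lambda>x. Shat j x lam)"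
      using S unfolding S_solutions_def by blast
    then have "f j absolutely_integrable_on {0<..<x}"
      "Shat j x lam = column j (Chat \<mu> c0 (of_real x * lam)) + integral {0<..<x} (f j)"
      using x unfolding S_volterra_def Let_def f_def by blast+
    then show ?thesis
      using integrable_integral[OF set_lebesgue_integral_eq_integral(1)] by simp
  qed
  let ?c = "\<lambda>j. g $ j * of_real x powr mu_j \<mu> j"
  have sum: "((\<lambda>t. ?c 1 *s f 1 t + ?c 2 *s f 2 t) has_integral
      (?c 1 *s (Shat 1 x lam - column 1 (Chat \<mu> c0 (of_real x * lam))) +
       ?c 2 *s (Shat 2 x lam - column 2 (Chat \<mu> c0 (of_real x * lam))))) {0<..<x}"
    by (intro has_integral_add has_integral_cscale f)
  have val: "?c 1 *s (Shat 1 x lam - column 1 (Chat \<mu> c0 (of_real x * lam))) +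
       ?c 2 *s (Shat 2 x lam - column 2 (Chat \<mu> c0 (of_real x * lam)))
     = Smat \<mu> Shat x lam *v g - Clam \<mu> c0 x lam *v g"
    by (simp add: Smat_def Clam_def entrywise algebra_simps)
  have int: "?c 1 *s f 1 t + ?c 2 *s f 2 t
     = (1 / (2 * \<i>)) *s (emat e (of_real x * lam) *v
              (Bmat *v Q_moment e q1 q2 lam (\<lambda>s. Smat \<mu> Shat s lam *v g) t))"
    if t: "t \<in> {0<..<x}" for t
  proof -
    have pw: "of_real x powr m * of_real (t / x) powr m = of_real t powr m" for m :: complex
      using t by (subst powr_times_real[symmetric]) auto
    have "?c 1 *s f 1 t + ?c 2 *s f 2 t
       = (g $ 1 * (of_real x powr mu_j \<mu> 1 * of_real (t / x) powr mu_j \<mu> 1)) *s (?M t *v Shat 1 t lam)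
       + (g $ 2 * (of_real x powr mu_j \<mu> 2 * of_real (t / x) powr mu_j \<mu> 2)) *s (?M t *v Shat 2 t lam)"
      unfolding f_def vector_smult_assoc mult.assoc ..
    also have "\<dots> = ?M t *v ((g $ 1 * of_real t powr mu_j \<mu> 1) *s Shat 1 t lam
                          + (g $ 2 * of_real t powr mu_j \<mu> 2) *s Shat 2 t lam)"
      unfolding pw matrix_vector_right_distrib vector_scalar_commute ..
    also have "(g $ 1 * of_real t powr mu_j \<mu> 1) *s Shat 1 t lam
                          + (g $ 2 * of_real t powr mu_j \<mu> 2) *s Shat 2 t lam = Smat \<mu> Shat t lam *v g"
      by (simp add: Smat_def entrywise algebra_simps)
    also have "?M t *v (Smat \<mu> Shat t lam *v g)
       = (Clam \<mu> c0 x lam ** matrix_inv (Clam \<mu> c0 t lam) ** Bmat) *v (Qpot q1 q2 t *v (Smat \<mu> Shat t lam *v g))"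
      by (simp only: matrix_vector_mul_assoc[symmetric])
    also have "\<dots> = (1 / (2 * \<i>)) *s (emat e (of_real x * lam) *v
              (Bmat *v Q_moment e q1 q2 lam (\<lambda>s. Smat \<mu> Shat s lam *v g) t))"
    proof -
      have "t > 0" using t by simp
      note kernel = Clam_kernel[OF jost conn lam x \<open>t > 0\<close>]
      show ?thesis
        by (simp only: kernel cscale_mult_vec Q_moment_def matrix_vector_mul_assoc[symmetric])
    qed
    finally show ?thesis .
  qed
  show ?thesis
    by (rule has_integral_eq[OF _ sum[unfolded val]]) (rule int)
qed

section \<open>The solutions E near the origin\<close>

abbreviation F_inner :: "complex \<Rightarrow> complex \<Rightarrow> real \<Rightarrow> complex" where
  "F_inner \<mu> lam x \<equiv> (of_real x * lam) powr (- \<mu>)"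

lemma inner_interval:
  assumes "lam \<in> lam_sector" "0 < x" "x < a_lam \<mu> lam"
  shows "cmod (of_real x * lam) < 2 * cmod \<mu>" "F_inner \<mu> lam x \<noteq> 0"
proof -
  have "Im lam > 0" by (rule lam_sector_Im_pos[OF assms(1)])
  then have "lam \<noteq> 0" by auto
  with assms show "cmod (of_real x * lam) < 2 * cmod \<mu>" "F_inner \<mu> lam x \<noteq> 0"
    by (auto simp: a_lam_def norm_mult field_simps)
qed

lemma Fj_inner:
  assumes "lam \<in> lam_sector" "0 < x" "x < a_lam \<mu> lam"
  shows "Fj \<mu> j (of_real x * lam) = F_inner \<mu> lam x"
  using inner_interval(1)[OF assms] by (simp add: Fj_def)

lemma U0mat_inner:
  assumes "lam \<in> lam_sector" "0 < x" "x < a_lam \<mu> lam"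
  shows "F_inner \<mu> lam x *m U0mat \<mu> e x lam = emat e (of_real x * lam)"
proof -
  let ?f = "F_inner \<mu> lam x"
  have F: "Fmat \<mu> (of_real x * lam) = diag (\<lambda>j. ?f)"
    unfolding Fmat_def Fj_inner[OF assms] ..
  have "det (diag (\<lambda>j. ?f)) \<noteq> 0"
    using inner_interval(2)[OF assms] by (simp add: det_2 diag_def)
  then have "matrix_inv (diag (\<lambda>j. ?f)) ** diag (\<lambda>j. ?f) = mat 1"
    by (rule matrix_inv_mult)
  moreover have "A ** diag (\<lambda>j. ?f) = ?f *m A" for A
    by (simp add: entrywise)
  ultimately have "?f *m matrix_inv (diag (\<lambda>j. ?f)) = mat 1" by simp
  then show ?thesis
    unfolding U0mat_def F cscale_matrix_mult(1)[symmetric] by simp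
qed

lemma Q_moment_inner:
  assumes "lam \<in> lam_sector" "0 < t" "t < a_lam \<mu> lam"
  shows "Q_moment e q1 q2 lam (\<lambda>s. F_inner \<mu> lam s *s u s) t
    = (F_inner \<mu> lam t)\<^sup>2 *s ((transpose (U0mat \<mu> e t lam) ** Qpot q1 q2 t) *v u t)"
  unfolding Q_moment_def U0mat_inner[OF assms, symmetric] transpose_cscale cscale_mult_vec
  by (simp add: vector_scalar_commute vector_smult_assoc power2_eq_square flip: matrix_vector_mul_assoc)

text \<open>
  Below \<open>a\<^sub>\<lambda>\<close> both diagonal entries of \<open>F\<close> agree, hence \<open>N(x, t, \<lambda>) = F(t \<lambda>)\<^sup>2 B\<close>, and the equation
  for \<open>U\<^sub>2\<close> turns into variation of constants for \<open>E\<^sub>2\<close> with model part exactly \<open>e\<^sub>2\<close>.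
\<close>

lemma U2_inner:
  assumes eq: "U2_equation \<mu> q1 q2 e lam u"
    and inner: "lam \<in> lam_sector" "0 < x" "x < a_lam \<mu> lam"
  shows "((\<lambda>t. (1 / (2 * \<i>)) *s (emat e (of_real x * lam) *v
              (Bmat *v Q_moment e q1 q2 lam (\<lambda>s. F_inner \<mu> lam s *s u s) t)))
          has_integral (F_inner \<mu> lam x *s u x - e 2 (of_real x * lam))) {0<..<x}"
proof -
  let ?f = "F_inner \<mu> lam" and ?a = "a_lam \<mu> lam" and ?U0 = "\<lambda>t. U0mat \<mu> e t lam"
  let ?V = "\<lambda>t. (transpose (?U0 t) ** Qpot q1 q2 t) *v u t"
  let ?I = "integral {0<..<x} (\<lambda>t. Nmat \<mu> x t lam *v ?V t)"
  have int: "(\<lambda>t. Nmat \<mu> x t lam *v ?V t) absolutely_integrable_on {0<..<x}"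
    and u: "u x = column 2 (?U0 x) + (1 / (2 * \<i>)) *s (?U0 x *v ?I)"
    using eq inner unfolding U2_equation_def Let_def by blast+
  have N: "Nmat \<mu> x t lam *v ?V t = Bmat *v Q_moment e q1 q2 lam (\<lambda>s. ?f s *s u s) t"
    if t: "t \<in> {0<..<x}" for t
  proof -
    have t': "0 < t" "t < ?a" using t inner by auto
    have "Nmat \<mu> x t lam = (?f t)\<^sup>2 *m Bmat"
      unfolding Nmat_def Let_def Fj_inner[OF inner] Fj_inner[OF inner(1) t']
      using inner_interval(2)[OF inner]
      by (simp add: entrywise Bmat_def B1mat_def B2mat_def power2_eq_square)
    then show ?thesis
      unfolding Q_moment_inner[OF inner(1) t'] by (simp add: cscale_mult_vec vector_scalar_commute)
  qed
  have "((\<lambda>t. Nmat \<mu> x t lam *v ?V t) has_integral ?I) {0<..<x}"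
    by (rule integrable_integral[OF set_lebesgue_integral_eq_integral(1)[OF int]])
  from has_integral_eq[OF N this]
  have "((\<lambda>t. Bmat *v Q_moment e q1 q2 lam (\<lambda>s. ?f s *s u s) t) has_integral ?I) {0<..<x}" .
  then have "((\<lambda>t. (1 / (2 * \<i>)) *s (emat e (of_real x * lam) *v
              (Bmat *v Q_moment e q1 q2 lam (\<lambda>s. ?f s *s u s) t)))
          has_integral (1 / (2 * \<i>)) *s (emat e (of_real x * lam) *v ?I)) {0<..<x}"
    by (intro has_integral_cscale has_integral_matrix_vector)
  moreover have "?f x *s u x - e 2 (of_real x * lam)
      = (1 / (2 * \<i>)) *s (emat e (of_real x * lam) *v ?I)"
  proof -
    have "?f x *s column 2 (?U0 x) = column 2 (?f x *m ?U0 x)"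
      by (simp add: entrywise)
    also have "\<dots> = e 2 (of_real x * lam)"
      unfolding U0mat_inner[OF inner] by (simp add: emat_def entrywise)
    finally have "?f x *s u x = e 2 (of_real x * lam) + (1 / (2 * \<i>)) *s ((?f x *m ?U0 x) *v ?I)"
      by (subst u) (simp add: vector_add_ldistrib cscale_mult_vec vector_smult_assoc mult.commute)
    then show ?thesis unfolding U0mat_inner[OF inner] by simp
  qed
  ultimately show ?thesis by simp
qed

text \<open>
  In the equation for \<open>U\<^sub>1\<close> the integral over \<open>(x, a\<^sub>\<lambda>)\<close> is the integral over \<open>(0, a\<^sub>\<lambda>)\<close> minus that
  over \<open>(0, x)\<close>. The latter completes \<open>B\<^sub>1\<close> to \<open>B = B\<^sub>1 + B\<^sub>2\<close>, and all remaining terms do not depend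
  on \<open>x\<close>. They stand behind \<open>B\<^sub>2\<close>, so together they add a constant multiple \<open>\<kappa>\<close> of \<open>e\<^sub>2\<close> to the model
  part \<open>e\<^sub>1\<close>.
\<close>

lemma U1_inner:
  assumes eq: "U1_equation \<mu> q1 q2 e lam u" and lam: "lam \<in> lam_sector" and a: "a_lam \<mu> lam > 0"
  obtains \<kappa> where
    "Q_moment e q1 q2 lam (\<lambda>s. F_inner \<mu> lam s *s u s) integrable_on {0<..<a_lam \<mu> lam}"
    "\<And>x. 0 < x \<Longrightarrow> x < a_lam \<mu> lam \<Longrightarrow>
      F_inner \<mu> lam x *s u x = e 1 (of_real x * lam) + \<kappa> *s e 2 (of_real x * lam)
        + (1 / (2 * \<i>)) *s (emat e (of_real x * lam) *v (Bmat *v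
             integral {0<..<x} (Q_moment e q1 q2 lam (\<lambda>s. F_inner \<mu> lam s *s u s))))"
proof -
  let ?f = "F_inner \<mu> lam" and ?a = "a_lam \<mu> lam" and ?U0 = "\<lambda>t. U0mat \<mu> e t lam"
  let ?F1 = "\<lambda>s::real. Fj \<mu> 1 (of_real s * lam)" and ?F2 = "\<lambda>s::real. Fj \<mu> 2 (of_real s * lam)"
  let ?V = "\<lambda>t. (transpose (?U0 t) ** Qpot q1 q2 t) *v u t"
  let ?W = "\<lambda>t. (transpose (?U0 t) ** Bmat ** Lmat \<mu> q1 q2 t lam) *v u t"
  let ?P = "(matrix_inv (Qlam \<mu> ?a lam) ** Qpot q1 q2 ?a) *v u ?a"
  let ?h = "Q_moment e q1 q2 lam (\<lambda>s. ?f s *s u s)"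
  \<comment> \<open>All terms behind \<open>B\<^sub>2\<close> that do not depend on \<open>x\<close>, with the sign of \<open>- B\<^sub>2\<close>; only the first
    component of \<open>w\<close> survives the multiplication by \<open>B\<^sub>2\<close>.\<close>
  define w where "w = integral {0<..<?a} ?h - (1/2) *s integral {?a<..} (\<lambda>t. (?F1 t)\<^sup>2 *s ?W t)
      - (1/2) *s ((?F1 ?a)\<^sup>2 *s ((transpose (?U0 ?a) ** Bmat) *v ?P))"
  have h: "?h t = (?F1 t * ?F2 t) *s ?V t" "?h t = (?F1 t)\<^sup>2 *s ?V t" if "0 < t" "t < ?a" for t
    unfolding Fj_inner[OF lam that] Q_moment_inner[OF lam that] by (simp_all add: power2_eq_square)
  have "(\<lambda>t. (?F1 t * ?F2 t) *s ?V t) absolutely_integrable_on {0<..<?a}"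
    using eq unfolding U1_equation_def Let_def by blast
  then have "(\<lambda>t. (?F1 t * ?F2 t) *s ?V t) integrable_on {0<..<?a}"
    by (rule set_lebesgue_integral_eq_integral(1))
  then have int: "?h integrable_on {0<..<?a}"
    by (rule integrable_eq) (simp add: h)
  show ?thesis
  proof (rule that[OF int, of "w $ 1 / (2 * \<i>)"])
    fix x assume x: "0 < x" "x < ?a"
    note inner = lam x
    have u: "u x = column 1 (?U0 x) +
          (1 / (2 * \<i>)) *s (?U0 x *v
            (B1mat *v integral {0<..<x} (\<lambda>t. (?F1 t * ?F2 t) *s ?V t)
             - B2mat *v integral {x<..<?a} (\<lambda>t. (?F1 t)\<^sup>2 *s ?V t)
             + (1/2) *s (B2mat *v integral {?a<..} (\<lambda>t. (?F1 t)\<^sup>2 *s ?W t))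
             + (1/2) *s (B2mat *v ((?F1 ?a)\<^sup>2 *s ((transpose (?U0 ?a) ** Bmat) *v ?P)))))"
      using eq x unfolding U1_equation_def Let_def by blast
    have I1: "integral {0<..<x} (\<lambda>t. (?F1 t * ?F2 t) *s ?V t) = integral {0<..<x} ?h"
      using x by (intro integral_cong) (simp add: h)
    have I2: "integral {x<..<?a} (\<lambda>t. (?F1 t)\<^sup>2 *s ?V t) = integral {x<..<?a} ?h"
      by (intro integral_cong h(2)[symmetric]) (use x in auto)
    have "integral {0..x} ?h + integral {x..?a} ?h = integral {0..?a} ?h"
      using x int
      by (intro Henstock_Kurzweil_Integration.integral_combine)
         (simp_all add: integrable_on_open_interval_real)
    then have I3: "integral {x<..<?a} ?h = integral {0<..<?a} ?h - integral {0<..<x} ?h"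
      by (simp add: integral_open_interval_real algebra_simps)
    have split: "B1mat *v i - B2mat *v (j - i) + (1/2) *s (B2mat *v k) + (1/2) *s (B2mat *v l)
       = Bmat *v i - B2mat *v (j - (1/2) *s k - (1/2) *s l)" for i j k l
      by (simp add: entrywise B1mat_def B2mat_def Bmat_def algebra_simps)
    have "?f x *s column 1 (?U0 x) = column 1 (?f x *m ?U0 x)"
      by (simp add: entrywise)
    also have "\<dots> = e 1 (of_real x * lam)"
      unfolding U0mat_inner[OF inner] by (simp add: emat_def entrywise)
    finally have col: "?f x *s column 1 (?U0 x) = e 1 (of_real x * lam)" .
    have "?f x *s u x = e 1 (of_real x * lam) + (1 / (2 * \<i>)) *s ((?f x *m ?U0 x) *v
            (Bmat *v integral {0<..<x} ?h - B2mat *v w))"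
      unfolding u I1 I2 I3 split w_def vector_add_ldistrib col
      by (simp only: cscale_mult_vec vector_smult_assoc mult.commute)
    also have "\<dots> = e 1 (of_real x * lam) + (w $ 1 / (2 * \<i>)) *s e 2 (of_real x * lam)
        + (1 / (2 * \<i>)) *s (emat e (of_real x * lam) *v (Bmat *v integral {0<..<x} ?h))"
    proof -
      have "emat e z *v (b - B2mat *v w) = emat e z *v b + w $ 1 *s e 2 z" for z b
        by (simp add: emat_def entrywise B2mat_def algebra_simps)
      then show ?thesis
        unfolding U0mat_inner[OF inner] by (simp add: vector_add_ldistrib vector_smult_assoc)
    qed
    finally show "?f x *s u x = e 1 (of_real x * lam) + (w $ 1 / (2 * \<i>)) *s e 2 (of_real x * lam)
        + (1 / (2 * \<i>)) *s (emat e (of_real x * lam) *v (Bmat *v integral {0<..<x} ?h))" .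
  qed
qed

section \<open>Reading off and estimating the coefficients\<close>

text \<open>
  Since \<open>C(x, \<lambda>) = C(x \<lambda>) diag(\<lambda>\<^bsup>-\<mu>\<^sub>j\<^esup>)\<close> and \<open>e = C \<gamma>0\<close>, an equality of model parts at a single point
  determines the coefficients.
\<close>

lemma coefficients_from_Clam:
  assumes conn: "\<And>z. z \<in> Pi_minus \<Longrightarrow> emat e z = Cmodel \<mu> c0 z ** \<gamma>0"
    and jost: "jost_solutions \<mu> e" and lam: "lam \<in> lam_sector" and "x > 0"
    and eq: "Clam \<mu> c0 x lam *v g = emat e (of_real x * lam) *v v"
  shows "g $ j = lam powr mu_j \<mu> j * (\<gamma>0 *v v) $ j"
proof -
  let ?z = "of_real x * lam" and ?D = "diag (\<lambda>j. lam powr - mu_j \<mu> j)"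
  have lam0: "lam \<noteq> 0" using lam_sector_Im_pos[OF lam] by auto
  have Im: "Im ?z > 0" using lam_sector_Im_pos[OF lam] \<open>x > 0\<close> by simp
  then have Pi: "?z \<in> Pi_minus" by (rule upper_half_plane_Pi_minus)
  have "det (Cmodel \<mu> c0 ?z) \<noteq> 0"
    using det_emat[OF jost Im] conn[OF Pi] by (auto simp: det_mul)
  note inv = matrix_inv_mult(1)[OF this]
  have "Cmodel \<mu> c0 ?z *v (?D *v g) = Cmodel \<mu> c0 ?z *v (\<gamma>0 *v v)"
    using eq unfolding Clam_eq_Cmodel[OF \<open>x > 0\<close> lam0] conn[OF Pi] matrix_vector_mul_assoc .
  then have "matrix_inv (Cmodel \<mu> c0 ?z) *v (Cmodel \<mu> c0 ?z *v (?D *v g))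
      = matrix_inv (Cmodel \<mu> c0 ?z) *v (Cmodel \<mu> c0 ?z *v (\<gamma>0 *v v))"
    by (rule arg_cong)
  then have "?D *v g = \<gamma>0 *v v"
    unfolding matrix_vector_mul_assoc matrix_mul_assoc inv by simp
  then have "(?D *v g) $ j = (\<gamma>0 *v v) $ j" by simp
  moreover have "(?D *v g) $ j = lam powr - mu_j \<mu> j * g $ j"
    by (simp add: diag_def matrix_vector_mult_def if_distrib if_distribR cong: if_cong)
  ultimately have "lam powr mu_j \<mu> j * (\<gamma>0 *v v) $ j
      = (lam powr mu_j \<mu> j * lam powr - mu_j \<mu> j) * g $ j"
    by (simp only: mult.assoc)
  also have "\<dots> = g $ j" using lam0 by (simp flip: powr_add)
  finally show ?thesis by simp
qed

text \<open>
  The quotient is \<open>z\<^bsup>\<mu>\<^esup> e\<^sub>k(z)\<close> at \<open>z = x \<lambda>\<close>. The factor cancels the power of the singular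
  solution \<open>C\<^sub>1\<close> and turns that of the regular solution \<open>C\<^sub>2\<close> into \<open>z\<^bsup>2\<mu>\<^esup>\<close>, which tends to 0.
\<close>

lemma jost_at_origin:
  assumes conn: "\<And>z. z \<in> Pi_minus \<Longrightarrow> emat e z = Cmodel \<mu> c0 z ** \<gamma>0"
    and "Re \<mu> > 0" and lam: "lam \<in> lam_sector"
  shows "((\<lambda>x. e k (of_real x * lam) $ 2 / F_inner \<mu> lam x) \<longlongrightarrow> - c0 1 * \<gamma>0 $ 1 $ k) (at_right 0)"
proof -
  let ?z = "\<lambda>x. of_real x * lam"
  have lam0: "lam \<noteq> 0" using lam_sector_Im_pos[OF lam] by auto
  have z: "(?z \<longlongrightarrow> 0) (at_right 0)"
    by (rule tendsto_eq_intros refl | simp)+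
  have zmu: "((\<lambda>x. (?z x) powr \<mu>) \<longlongrightarrow> 0) (at_right 0)"
  proof (rule tendsto_norm_zero_cancel, rule Lim_transform_eventually)
    have "((\<lambda>x. x powr Re \<mu>) \<longlongrightarrow> 0) (at_right (0::real))"
      by (rule tendsto_zero_powrI[where b = "Re \<mu>"])
         (auto intro: tendsto_ident_at simp: eventually_at_filter assms(2))
    then show "((\<lambda>x. x powr Re \<mu> * norm (lam powr \<mu>)) \<longlongrightarrow> 0) (at_right 0)"
      by (rule tendsto_mult_left_zero)
    show "\<forall>\<^sub>F x in at_right 0. x powr Re \<mu> * norm (lam powr \<mu>) = norm ((?z x) powr \<mu>)"
      using eventually_at_right_less[of 0]
      by eventually_elim (simp add: powr_times_real_left norm_mult norm_powr_real_powr)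
  qed
  have ev: "((\<lambda>x. even_series \<mu> c0 1 ((?z x)\<^sup>2)) \<longlongrightarrow> even_series \<mu> c0 1 (0\<^sup>2)) (at_right 0)"
    by (intro isCont_tendsto_compose[OF isCont_even_series] tendsto_power z)
  have od: "((\<lambda>x. odd_series \<mu> c0 2 ((?z x)\<^sup>2)) \<longlongrightarrow> odd_series \<mu> c0 2 (0\<^sup>2)) (at_right 0)"
    by (intro isCont_tendsto_compose[OF isCont_odd_series] tendsto_power z)
  have "((\<lambda>x. - even_series \<mu> c0 1 ((?z x)\<^sup>2) * \<gamma>0 $ 1 $ k
        + ?z x * odd_series \<mu> c0 2 ((?z x)\<^sup>2) * ((?z x) powr \<mu>)\<^sup>2 * \<gamma>0 $ 2 $ k) \<longlongrightarrow>
      - even_series \<mu> c0 1 (0\<^sup>2) * \<gamma>0 $ 1 $ k + 0 * odd_series \<mu> c0 2 (0\<^sup>2) * 0\<^sup>2 * \<gamma>0 $ 2 $ k) (at_right 0)"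
    by (intro tendsto_add tendsto_mult tendsto_minus tendsto_power tendsto_const z zmu ev od)
  moreover have "\<forall>\<^sub>F x in at_right 0. - even_series \<mu> c0 1 ((?z x)\<^sup>2) * \<gamma>0 $ 1 $ k
        + ?z x * odd_series \<mu> c0 2 ((?z x)\<^sup>2) * ((?z x) powr \<mu>)\<^sup>2 * \<gamma>0 $ 2 $ k
      = e k (?z x) $ 2 / F_inner \<mu> lam x"
    using eventually_at_right_less[of 0]
  proof eventually_elim
    case (elim x)
    have "Im (?z x) > 0" using lam_sector_Im_pos[OF lam] elim by simp
    then have Pi: "?z x \<in> Pi_minus" by (rule upper_half_plane_Pi_minus)
    have nz: "?z x \<noteq> 0" using elim lam0 by simp
    let ?p = "?z x powr \<mu>"
    have p: "?p \<noteq> 0" using nz by (simp add: powr_eq_0_iff)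
    have "e k (?z x) $ 2 = emat e (?z x) $ 2 $ k" by (simp add: emat_def of_cols_def)
    also have "\<dots> = - even_series \<mu> c0 1 ((?z x)\<^sup>2) * inverse ?p * \<gamma>0 $ 1 $ k
        + ?z x * odd_series \<mu> c0 2 ((?z x)\<^sup>2) * ?p * \<gamma>0 $ 2 $ k"
      unfolding conn[OF Pi] Cmodel_def Chat_eq
      by (simp add: matrix_matrix_mult_def sum_2 diag_def powr_minus)
    finally show ?case using p
      unfolding powr_minus by (simp add: power2_eq_square field_simps)
  qed
  ultimately show ?thesis
    using Lim_transform_eventually by (simp add: even_series_0)
qed

text \<open>
  As \<open>x\<close> tends to 0, the integral term of \<open>U\<^sub>1 - U\<^sub>1\<^sup>0\<close> vanishes, while the second component of the extra term tends to
  \<open>- c\<^sub>1\<^sub>0 \<gamma>\<^sup>0\<^sub>1\<^sub>2 \<kappa>\<close>; so a uniform bound on \<open>U\<^sub>1 - U\<^sub>1\<^sup>0\<close> bounds \<open>\<kappa>\<close> without any estimate of the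
  integrals that make it up.
\<close>

lemma extra_coefficient_bound:
  assumes conn: "\<And>z. z \<in> Pi_minus \<Longrightarrow> emat e z = Cmodel \<mu> c0 z ** \<gamma>0"
    and \<mu>: "Re \<mu> > 0" and lam: "lam \<in> lam_sector" and a: "0 < a" "a \<le> a_lam \<mu> lam"
    and h: "h integrable_on {0<..<a}"
    and u: "\<And>x. 0 < x \<Longrightarrow> x < a \<Longrightarrow>
      F_inner \<mu> lam x *s u x = e 1 (of_real x * lam) + \<kappa> *s e 2 (of_real x * lam)
        + (1 / (2 * \<i>)) *s (emat e (of_real x * lam) *v (Bmat *v integral {0<..<x} h))"
    and bound: "\<And>x. 0 < x \<Longrightarrow> norm (u x - column 1 (U0mat \<mu> e x lam)) \<le> \<epsilon>"
  shows "cmod \<kappa> * (cmod (c0 1) * cmod (\<gamma>0 $ 1 $ 2)) \<le> \<epsilon>"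
proof -
  let ?v = "\<lambda>k x. e k (of_real x * lam) $ 2 / F_inner \<mu> lam x"
  let ?I = "\<lambda>x. integral {0<..<x} h"
  let ?d = "\<lambda>x. \<kappa> * ?v 2 x + 1 / (2 * \<i>) * (?v 1 x * ?I x $ 2 - ?v 2 x * ?I x $ 1)"
  have "h integrable_on {0..a}"
    using h by (simp add: integrable_on_open_interval_real)
  then have "continuous_on {0..a} (\<lambda>x. integral {0..x} h)"
    by (rule indefinite_integral_continuous_1)
  then have "((\<lambda>x. integral {0..x} h) \<longlongrightarrow> integral {0..0} h) (at 0 within {0..a})"
    unfolding continuous_on_def by (rule bspec) (use a(1) in simp)
  then have "(?I \<longlongrightarrow> 0) (at 0 within {0..a})"
    unfolding integral_open_interval_real by simp
  then have "(?I \<longlongrightarrow> 0) (at_right 0)"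
    using at_within_Icc_at_right[OF a(1)] by simp
  then have I: "((\<lambda>x. ?I x $ i) \<longlongrightarrow> 0) (at_right 0)" for i
    using tendsto_vec_nth by fastforce
  have v: "(?v k \<longlongrightarrow> - c0 1 * \<gamma>0 $ 1 $ k) (at_right 0)" for k
    by (rule jost_at_origin[OF conn \<mu> lam])
  have "((\<lambda>x. cmod (?d x)) \<longlongrightarrow> cmod (\<kappa> * (- c0 1 * \<gamma>0 $ 1 $ 2) + 1 / (2 * \<i>) *
        ((- c0 1 * \<gamma>0 $ 1 $ 1) * 0 - (- c0 1 * \<gamma>0 $ 1 $ 2) * 0))) (at_right 0)"
    by (intro tendsto_norm tendsto_add tendsto_mult tendsto_diff tendsto_const v I)
  then have lim: "((\<lambda>x. cmod (?d x)) \<longlongrightarrow> cmod \<kappa> * (cmod (c0 1) * cmod (\<gamma>0 $ 1 $ 2))) (at_right 0)"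
    by (simp add: norm_mult)
  have "\<forall>\<^sub>F x in at_right 0. x \<in> {0<..<a}"
    by (rule eventually_at_right_real[OF a(1)])
  then have "\<forall>\<^sub>F x in at_right 0. cmod (?d x) \<le> \<epsilon>"
  proof eventually_elim
    case (elim x)
    then have x: "0 < x" "x < a" by auto
    note inner = lam x(1) less_le_trans[OF x(2) a(2)]
    let ?f = "F_inner \<mu> lam x" and ?z = "of_real x * lam"
    have f: "?f \<noteq> 0" by (rule inner_interval(2)[OF inner])
    have "?f * (u x $ 2 - U0mat \<mu> e x lam $ 2 $ 1) = ?f * ?d x"
    proof -
      have "?f * U0mat \<mu> e x lam $ 2 $ 1 = (?f *m U0mat \<mu> e x lam) $ 2 $ 1"
        by (simp add: cscale_def)
      also have "\<dots> = e 1 ?z $ 2"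
        unfolding U0mat_inner[OF inner] by (simp add: emat_def of_cols_def)
      finally have U0: "?f * U0mat \<mu> e x lam $ 2 $ 1 = e 1 ?z $ 2" .
      have "?f * u x $ 2 = (?f *s u x) $ 2" by simp
      also have "\<dots> = e 1 ?z $ 2 + \<kappa> * e 2 ?z $ 2
          + 1 / (2 * \<i>) * (e 1 ?z $ 2 * ?I x $ 2 - e 2 ?z $ 2 * ?I x $ 1)"
        unfolding u[OF x]
        by (simp add: emat_def of_cols_def matrix_vector_mult_def sum_2 Bmat_def)
      finally have fu: "?f * u x $ 2 = e 1 ?z $ 2 + \<kappa> * e 2 ?z $ 2
          + 1 / (2 * \<i>) * (e 1 ?z $ 2 * ?I x $ 2 - e 2 ?z $ 2 * ?I x $ 1)" .
      have "?f * ?v k x = e k ?z $ 2" for k using f by simp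
      moreover have "?f * ?d x = \<kappa> * (?f * ?v 2 x)
          + 1 / (2 * \<i>) * ((?f * ?v 1 x) * ?I x $ 2 - (?f * ?v 2 x) * ?I x $ 1)"
        by (simp only: ring_distribs right_diff_distrib mult_ac)
      ultimately show ?thesis
        unfolding right_diff_distrib U0 fu by simp
    qed
    then have "?d x = (u x - column 1 (U0mat \<mu> e x lam)) $ 2"
      using f by (simp add: column_def)
    then have "cmod (?d x) \<le> norm (u x - column 1 (U0mat \<mu> e x lam))"
      using Finite_Cartesian_Product.norm_nth_le by metis
    with bound[OF x(1)] show ?case by linarith
  qed
  then show ?thesis
    by (rule tendsto_upperbound[OF lim]) simp
qed

theorem theorem6:
  fixes \<mu> :: complex
    and c0 :: "2 \<Rightarrow> complex"
    and q1 q2 :: "real \<Rightarrow> complex"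
    and e :: "2 \<Rightarrow> complex \<Rightarrow> complex ^ 2"
    and Shat U :: "2 \<Rightarrow> real \<Rightarrow> complex \<Rightarrow> complex ^ 2"
    and R :: real
    and \<gamma>0 :: "complex ^ 2 ^ 2"
    and \<gamma> :: "complex \<Rightarrow> complex ^ 2 ^ 2"
  assumes "Re \<mu> > 0"
    and "\<And>n::nat. \<mu> - 1/2 \<noteq> of_nat n"
    and "c0 1 * c0 2 = 1"
    and "admissible_potential \<mu> q1 q2"
    and "jost_solutions \<mu> e"
    and "\<And>lam. lam \<in> lam_sector \<Longrightarrow> cmod lam \<ge> R \<Longrightarrow> S_solutions \<mu> c0 q1 q2 lam Shat"
    and "birkhoff_U \<mu> q1 q2 e R U"
    and "\<And>z. z \<in> Pi_minus \<Longrightarrow> emat e z = Cmodel \<mu> c0 z ** \<gamma>0"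
    and "\<And>lam x. lam \<in> lam_sector \<Longrightarrow> cmod lam \<ge> R \<Longrightarrow> x > 0 \<Longrightarrow>
           Emat \<mu> U x lam = Smat \<mu> Shat x lam ** \<gamma> lam"
  shows "(\<forall>lam\<in>lam_sector. cmod lam \<ge> R \<longrightarrow>
            (\<forall>j. \<gamma> lam $ j $ 2 = lam powr mu_j \<mu> j * \<gamma>0 $ j $ 2)) \<and>
         (\<forall>j. \<exists>g.
            (\<forall>lam\<in>lam_sector. cmod lam \<ge> R \<longrightarrow>
               \<gamma> lam $ j $ 1 = lam powr mu_j \<mu> j * \<gamma>0 $ j $ 1 * (1 + g lam)) \<and>
            g \<in> O[inf at_infinity (principal lam_sector)](\<lambda>lam. complex_of_real (cmod lam powr (- nu \<mu>))))"
proof -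
  note \<mu> = assms(1) and jost = assms(5) and S = assms(6) and conn = assms(8) and E = assms(9)
  obtain M where M: "\<And>lam j x. lam \<in> lam_sector \<Longrightarrow> cmod lam \<ge> R \<Longrightarrow> x > 0 \<Longrightarrow>
      norm (U j x lam - column j (U0mat \<mu> e x lam)) \<le> M * cmod lam powr (- nu \<mu>)"
    using assms(7) unfolding birkhoff_U_def by blast
  have U1: "U1_equation \<mu> q1 q2 e lam (\<lambda>x. U 1 x lam)"
    and U2: "U2_equation \<mu> q1 q2 e lam (\<lambda>x. U 2 x lam)"
    if "lam \<in> lam_sector" "cmod lam \<ge> R" for lam
    using assms(7) that unfolding birkhoff_U_def by blast+
  have a: "a_lam \<mu> lam > 0" if "lam \<in> lam_sector" for lam
    using lam_sector_Im_pos[OF that] \<mu> unfolding a_lam_def by (auto intro!: divide_pos_pos)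
  have \<gamma>0: "\<gamma>0 $ j $ k \<noteq> 0" for j k
    by (rule connection_coefficient_nonzero[OF jost conn])
  have Ecol: "F_inner \<mu> lam t *s U k t lam = Smat \<mu> Shat t lam *v column k (\<gamma> lam)"
    if "lam \<in> lam_sector" "cmod lam \<ge> R" "0 < t" "t < a_lam \<mu> lam" for lam t k
  proof -
    have "F_inner \<mu> lam t *s U k t lam = column k (Emat \<mu> U t lam)"
    proof -
      have F: "Fmat \<mu> (of_real t * lam) = diag (\<lambda>j. F_inner \<mu> lam t)"
        unfolding Fmat_def Fj_inner[OF that(1,3,4)] ..
      show ?thesis
        unfolding Emat_def F
        by (simp add: vec_eq_iff matrix_matrix_mult_def diag_def of_cols_def column_def
            if_distrib mult.commute cong: if_cong)
    qed
    also have "\<dots> = Smat \<mu> Shat t lam *v column k (\<gamma> lam)"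
      unfolding E[OF that(1-3)] by (simp add: entrywise)
    finally show ?thesis .
  qed
  have moments: "Q_moment e q1 q2 lam (\<lambda>s. Smat \<mu> Shat s lam *v column k (\<gamma> lam)) t
      = Q_moment e q1 q2 lam (\<lambda>s. F_inner \<mu> lam s *s U k s lam) t"
    if "lam \<in> lam_sector" "cmod lam \<ge> R" "0 < t" "t < a_lam \<mu> lam" for lam t k
    unfolding Q_moment_def Ecol[OF that] ..
  have second: "\<gamma> lam $ j $ 2 = lam powr mu_j \<mu> j * \<gamma>0 $ j $ 2"
    if lam: "lam \<in> lam_sector" "cmod lam \<ge> R" for lam j
  proof -
    \<comment> \<open>Any point below \<open>a\<^sub>\<lambda>\<close> would do: the coefficients do not depend on \<open>x\<close>.\<close>
    define x where "x = a_lam \<mu> lam / 2"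
    have x: "0 < x" "x < a_lam \<mu> lam" using a[OF lam(1)] by (simp_all add: x_def)
    let ?g = "column 2 (\<gamma> lam)"
    have "((\<lambda>t. (1 / (2 * \<i>)) *s (emat e (of_real x * lam) *v
              (Bmat *v Q_moment e q1 q2 lam (\<lambda>s. Smat \<mu> Shat s lam *v ?g) t)))
          has_integral (F_inner \<mu> lam x *s U 2 x lam - e 2 (of_real x * lam))) {0<..<x}"
      by (rule has_integral_eq[OF _ U2_inner[OF U2[OF lam] lam(1) x]]) (use moments[OF lam] x in auto)
    \<comment> \<open>\<open>E\<^sub>2 = S \<gamma>\<^sub>2\<close> occurs under both integrals, so the model parts agree as well.\<close>
    from has_integral_unique[OF this S_combination_has_integral[OF jost conn lam(1) x(1) S[OF lam]]]
    have "Clam \<mu> c0 x lam *v ?g = e 2 (of_real x * lam)"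
      unfolding Ecol[OF lam x] by (simp add: algebra_simps)
    also have "\<dots> = emat e (of_real x * lam) *v axis 2 1"
      by (simp add: emat_def entrywise axis_def)
    finally have "?g $ j = lam powr mu_j \<mu> j * (\<gamma>0 *v axis 2 1) $ j"
      by (intro coefficients_from_Clam[OF conn jost lam(1) x(1)])
    then show ?thesis
      by (simp add: column_def matrix_vector_mult_def sum_2 axis_def)
  qed
  define C where "C = cmod (c0 1) * cmod (\<gamma>0 $ 1 $ 2)"
  have "c0 1 \<noteq> 0" using assms(3) by auto
  then have C: "C > 0" using \<gamma>0 by (simp add: C_def)
  have first: "\<exists>\<kappa>. cmod \<kappa> * C \<le> M * cmod lam powr (- nu \<mu>) \<and>
      (\<forall>j. \<gamma> lam $ j $ 1 = lam powr mu_j \<mu> j * (\<gamma>0 $ j $ 1 + \<kappa> * \<gamma>0 $ j $ 2))"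
    if lam: "lam \<in> lam_sector" "cmod lam \<ge> R" for lam
  proof -
    define x where "x = a_lam \<mu> lam / 2"
    have x: "0 < x" "x < a_lam \<mu> lam" using a[OF lam(1)] by (simp_all add: x_def)
    let ?g = "column 1 (\<gamma> lam)" and ?z = "of_real x * lam"
    let ?h = "Q_moment e q1 q2 lam (\<lambda>s. F_inner \<mu> lam s *s U 1 s lam)"
    obtain \<kappa> where h: "?h integrable_on {0<..<a_lam \<mu> lam}"
      and \<kappa>: "\<And>x. 0 < x \<Longrightarrow> x < a_lam \<mu> lam \<Longrightarrow>
        F_inner \<mu> lam x *s U 1 x lam = e 1 (of_real x * lam) + \<kappa> *s e 2 (of_real x * lam)
          + (1 / (2 * \<i>)) *s (emat e (of_real x * lam) *v (Bmat *v integral {0<..<x} ?h))"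
      using U1_inner[OF U1[OF lam] lam(1) a[OF lam(1)]] by blast
    have "cmod \<kappa> * C \<le> M * cmod lam powr (- nu \<mu>)"
      unfolding C_def
      by (rule extra_coefficient_bound[OF conn \<mu> lam(1) a[OF lam(1)] order_refl h \<kappa> M[OF lam]])
    have "?h integrable_on {0..x}"
      by (rule integrable_on_subinterval[of _ "{0..a_lam \<mu> lam}"])
         (use h x in \<open>auto simp: integrable_on_open_interval_real\<close>)
    then have "(?h has_integral integral {0<..<x} ?h) {0<..<x}"
      by (intro integrable_integral) (simp add: integrable_on_open_interval_real)
    then have "((\<lambda>t. (1 / (2 * \<i>)) *s (emat e ?z *v (Bmat *v ?h t))) has_integral
        (1 / (2 * \<i>)) *s (emat e ?z *v (Bmat *v integral {0<..<x} ?h))) {0<..<x}"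
      by (intro has_integral_cscale has_integral_matrix_vector)
    then have "((\<lambda>t. (1 / (2 * \<i>)) *s (emat e ?z *v
              (Bmat *v Q_moment e q1 q2 lam (\<lambda>s. Smat \<mu> Shat s lam *v ?g) t)))
          has_integral (1 / (2 * \<i>)) *s (emat e ?z *v (Bmat *v integral {0<..<x} ?h))) {0<..<x}"
      by (rule has_integral_eq[rotated]) (use moments[OF lam] x in auto)
    from has_integral_unique[OF this S_combination_has_integral[OF jost conn lam(1) x(1) S[OF lam]]]
    have "Clam \<mu> c0 x lam *v ?g = e 1 ?z + \<kappa> *s e 2 ?z"
      unfolding Ecol[OF lam x, symmetric] \<kappa>[OF x] by (simp add: algebra_simps)
    also have "\<dots> = emat e ?z *v vector [1, \<kappa>]"
      by (simp add: emat_def entrywise)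
    finally have "?g $ j = lam powr mu_j \<mu> j * (\<gamma>0 *v vector [1, \<kappa>]) $ j" for j
      by (intro coefficients_from_Clam[OF conn jost lam(1) x(1)])
    then have "\<forall>j. \<gamma> lam $ j $ 1 = lam powr mu_j \<mu> j * (\<gamma>0 $ j $ 1 + \<kappa> * \<gamma>0 $ j $ 2)"
      by (simp add: column_def matrix_vector_mult_def sum_2 mult.commute)
    with \<open>cmod \<kappa> * C \<le> M * cmod lam powr (- nu \<mu>)\<close> show ?thesis by blast
  qed
  then obtain \<kappa> where \<kappa>: "\<And>lam. lam \<in> lam_sector \<Longrightarrow> cmod lam \<ge> R \<Longrightarrow>
      cmod (\<kappa> lam) * C \<le> M * cmod lam powr (- nu \<mu>) \<and>
      (\<forall>j. \<gamma> lam $ j $ 1 = lam powr mu_j \<mu> j * (\<gamma>0 $ j $ 1 + \<kappa> lam * \<gamma>0 $ j $ 2))"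
    by metis
  have "\<exists>g. (\<forall>lam\<in>lam_sector. cmod lam \<ge> R \<longrightarrow>
               \<gamma> lam $ j $ 1 = lam powr mu_j \<mu> j * \<gamma>0 $ j $ 1 * (1 + g lam)) \<and>
            g \<in> O[inf at_infinity (principal lam_sector)](\<lambda>lam. complex_of_real (cmod lam powr (- nu \<mu>)))"
    for j
  proof (intro exI conjI ballI impI)
    let ?g = "\<lambda>lam. \<kappa> lam * (\<gamma>0 $ j $ 2 / \<gamma>0 $ j $ 1)"
    fix lam assume lam: "lam \<in> lam_sector" "cmod lam \<ge> R"
    have "\<gamma>0 $ j $ 1 + \<kappa> lam * \<gamma>0 $ j $ 2 = \<gamma>0 $ j $ 1 * (1 + ?g lam)"
      using \<gamma>0[of j 1] by (simp add: field_simps)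
    then show "\<gamma> lam $ j $ 1 = lam powr mu_j \<mu> j * \<gamma>0 $ j $ 1 * (1 + ?g lam)"
      using \<kappa>[OF lam] by (metis mult.assoc)
  next
    let ?g = "\<lambda>lam. \<kappa> lam * (\<gamma>0 $ j $ 2 / \<gamma>0 $ j $ 1)"
    let ?r = "cmod (\<gamma>0 $ j $ 2 / \<gamma>0 $ j $ 1)"
    have "\<forall>\<^sub>F lam in at_infinity. R \<le> cmod lam"
      by (auto simp: eventually_at_infinity)
    then have "\<forall>\<^sub>F lam in inf at_infinity (principal lam_sector).
        norm (?g lam) \<le> (M / C * ?r) * norm (complex_of_real (cmod lam powr (- nu \<mu>)))"
      unfolding eventually_inf_principal
    proof eventually_elim
      case (elim lam)
      show ?case
      proof
        assume "lam \<in> lam_sector"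
        with elim \<kappa> have "cmod (\<kappa> lam) * C \<le> M * cmod lam powr (- nu \<mu>)" by blast
        with C have "cmod (\<kappa> lam) \<le> M * cmod lam powr (- nu \<mu>) / C"
          by (simp add: pos_le_divide_eq)
        then have "cmod (\<kappa> lam) * ?r \<le> M * cmod lam powr (- nu \<mu>) / C * ?r"
          by (rule mult_right_mono) simp
        moreover have "norm (?g lam) = cmod (\<kappa> lam) * ?r" by (rule norm_mult)
        moreover have "(M / C * ?r) * norm (complex_of_real (cmod lam powr (- nu \<mu>)))
            = M * cmod lam powr (- nu \<mu>) / C * ?r" by simp
        ultimately show "norm (?g lam)
            \<le> (M / C * ?r) * norm (complex_of_real (cmod lam powr (- nu \<mu>)))"
          by (simp only:)
      qed
    qed
    then show "?g \<in> O[inf at_infinity (principal lam_sector)](\<lambda>lam. complex_of_real (cmod lam powr (- nu \<mu>)))"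
      by (rule bigoI)
  qed
  with second show ?thesis by blast
qed

end
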